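(* Let $\mathcal{S}$ be the category of all $(\vee,0,1)$-semilattices with $(\vee,0,1)$-homomorphisms, and let $I$ be a finite poset. Then every diagram $\mathcal{D}\colon I\to\mathcal{S}$ has a lifting in the variety of all groupoids.
   Context: A groupoid is a set with one binary operation (no axioms). For an algebra $A$, $\mathrm{Con_c}A$ is the $(\vee,0)$-semilattice of compact (finitely generated) congruences of $A$. For a homomorphism $f\colon A\to B$, $\mathrm{Con_c}f\colon\mathrm{Con_c}A\to\mathrm{Con_c}B$ sends $\alpha$ to the congruence of $B$ generated by $\{(f(x),f(y)):(x,y)\in\alpha\}$; this makes $\mathrm{Con_c}$ a functor. A diagram $I\to\mathcal S$ is a functor from $I$, viewed as a category. A lifting of $\mathcal D$ in a variety $\mathcal V$ is a functor $\mathcal A\colon I\to\mathcal V$ such that $\mathrm{Con_c}\circ\mathcal A$ is naturally isomorphic to $\mathcal D$. *)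

theory Defs
  imports "HOL.Hull" "HOL-Algebra.Lattice" "HOL-Library.FuncSet"
begin

section \<open>Semilattices with bounds\<close>

text \<open>Join-semilattices are taken in their order-theoretic form; the join, the least element
  and the greatest element are those of the library.\<close>

locale join_semilattice0 = upper_semilattice + weak_partial_order_bottom

locale join_semilattice01 = join_semilattice0 + weak_partial_order_top

definition hom_join0 ::
  "('a, 'm) gorder_scheme \<Rightarrow> ('b, 'n) gorder_scheme \<Rightarrow> ('a \<Rightarrow> 'b) set" where
  "hom_join0 L M = {f \<in> carrier L \<rightarrow> carrier M.
     f \<bottom>\<^bsub>L\<^esub> = \<bottom>\<^bsub>M\<^esub> \<and>
     (\<forall>x\<in>carrier L. \<forall>y\<in>carrier L. f (x \<squnion>\<^bsub>L\<^esub> y) = f x \<squnion>\<^bsub>M\<^esub> f y)}"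

definition hom_join01 ::
  "('a, 'm) gorder_scheme \<Rightarrow> ('b, 'n) gorder_scheme \<Rightarrow> ('a \<Rightarrow> 'b) set" where
  "hom_join01 L M = {f \<in> hom_join0 L M. f \<top>\<^bsub>L\<^esub> = \<top>\<^bsub>M\<^esub>}"

definition iso_join0 ::
  "('a, 'm) gorder_scheme \<Rightarrow> ('b, 'n) gorder_scheme \<Rightarrow> ('a \<Rightarrow> 'b) set" where
  "iso_join0 L M = {f \<in> hom_join0 L M. bij_betw f (carrier L) (carrier M)}"


section \<open>Groupoids and their congruences\<close>

record 'a groupoid = "'a partial_object" +
  gmult :: "'a \<Rightarrow> 'a \<Rightarrow> 'a" (infixl \<open>\<cdot>\<index>\<close> 70)

text \<open>As usual in universal algebra, the underlying set of an algebra is nonempty.\<close>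

locale groupoid =
  fixes G (structure)
  assumes carrier_nonempty: "carrier G \<noteq> {}"
    and gmult_closed: "\<lbrakk>x \<in> carrier G; y \<in> carrier G\<rbrakk> \<Longrightarrow> x \<cdot> y \<in> carrier G"

definition hom_groupoid ::
  "('a, 'm) groupoid_scheme \<Rightarrow> ('b, 'n) groupoid_scheme \<Rightarrow> ('a \<Rightarrow> 'b) set" where
  "hom_groupoid G H = {f \<in> carrier G \<rightarrow> carrier H.
     \<forall>x\<in>carrier G. \<forall>y\<in>carrier G. f (x \<cdot>\<^bsub>G\<^esub> y) = f x \<cdot>\<^bsub>H\<^esub> f y}"

definition congruence :: "('a, 'm) groupoid_scheme \<Rightarrow> 'a rel \<Rightarrow> bool" where
  "congruence G \<theta> \<longleftrightarrow> equiv (carrier G) \<theta> \<and>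
     (\<forall>x x' y y'. (x, x') \<in> \<theta> \<longrightarrow> (y, y') \<in> \<theta> \<longrightarrow> (x \<cdot>\<^bsub>G\<^esub> y, x' \<cdot>\<^bsub>G\<^esub> y') \<in> \<theta>)"

definition Cg :: "('a, 'm) groupoid_scheme \<Rightarrow> 'a rel \<Rightarrow> 'a rel" where
  "Cg G X = congruence G hull X"

definition Con_c :: "('a, 'm) groupoid_scheme \<Rightarrow> 'a rel gorder" where
  "Con_c G = \<lparr>carrier = {Cg G X | X. finite X \<and> X \<subseteq> carrier G \<times> carrier G},
              eq = (=), le = (\<subseteq>)\<rparr>"

text \<open>The action of \<open>Con_c\<close> on a homomorphism \<open>f\<close> with codomain \<open>H\<close>.\<close>

definition Con_c_map :: "('b, 'n) groupoid_scheme \<Rightarrow> ('a \<Rightarrow> 'b) \<Rightarrow> 'a rel \<Rightarrow> 'b rel" where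
  "Con_c_map H f \<alpha> = Cg H {(f x, f y) | x y. (x, y) \<in> \<alpha>}"


section \<open>Diagrams and liftings\<close>

text \<open>Functors from the poset \<open>(I, r)\<close>, where \<open>(i, j) \<in> r\<close> means \<open>i \<le> j\<close>, to the concrete
  category with objects \<open>Ob\<close> and morphisms \<open>Hom\<close>.  Morphisms are functions on the whole type
  for which only the restriction to the carrier of the domain matters, so the functor laws
  are equalities on carriers.\<close>

locale poset_diagram =
  fixes I :: "'i set" and r :: "'i rel"
    and Ob :: "('a, 'm) partial_object_scheme \<Rightarrow> bool"
    and Hom :: "('a, 'm) partial_object_scheme \<Rightarrow> ('a, 'm) partial_object_scheme \<Rightarrow> ('a \<Rightarrow> 'a) set"
    and X :: "'i \<Rightarrow> ('a, 'm) partial_object_scheme"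
    and \<phi> :: "'i \<Rightarrow> 'i \<Rightarrow> 'a \<Rightarrow> 'a"
  assumes obj: "i \<in> I \<Longrightarrow> Ob (X i)"
    and hom: "(i, j) \<in> r \<Longrightarrow> \<phi> i j \<in> Hom (X i) (X j)"
    and ident: "\<lbrakk>i \<in> I; x \<in> carrier (X i)\<rbrakk> \<Longrightarrow> \<phi> i i x = x"
    and comp: "\<lbrakk>(i, j) \<in> r; (j, k) \<in> r; x \<in> carrier (X i)\<rbrakk> \<Longrightarrow> \<phi> j k (\<phi> i j x) = \<phi> i k x"

definition semilattice01_diagram ::
  "'i set \<Rightarrow> 'i rel \<Rightarrow> ('i \<Rightarrow> 'a gorder) \<Rightarrow> ('i \<Rightarrow> 'i \<Rightarrow> 'a \<Rightarrow> 'a) \<Rightarrow> bool" where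
  "semilattice01_diagram I r D \<phi> \<longleftrightarrow> poset_diagram I r join_semilattice01 hom_join01 D \<phi>"

definition groupoid_diagram ::
  "'i set \<Rightarrow> 'i rel \<Rightarrow> ('i \<Rightarrow> 'b groupoid) \<Rightarrow> ('i \<Rightarrow> 'i \<Rightarrow> 'b \<Rightarrow> 'b) \<Rightarrow> bool" where
  "groupoid_diagram I r A f \<longleftrightarrow> poset_diagram I r groupoid hom_groupoid A f"

text \<open>The components \<open>h i\<close> of the natural isomorphism are isomorphisms of join-semilattices
  with least element; any such isomorphism also preserves an existing greatest element.
  A lifting has its carriers in a type \<open>'b\<close> that may differ from \<open>'a\<close>.  For a finite poset
  \<open>'b = 'a list\<close>, of cardinality the maximum of that of \<open>'a\<close> and aleph-zero, is large enough:
  a Loewenheim-Skolem closure reduces any lifting to that size.\<close>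

definition groupoid_lifting ::
  "'i set \<Rightarrow> 'i rel \<Rightarrow> ('i \<Rightarrow> 'a gorder) \<Rightarrow> ('i \<Rightarrow> 'i \<Rightarrow> 'a \<Rightarrow> 'a)
    \<Rightarrow> ('i \<Rightarrow> 'b groupoid) \<Rightarrow> ('i \<Rightarrow> 'i \<Rightarrow> 'b \<Rightarrow> 'b) \<Rightarrow> bool" where
  "groupoid_lifting I r D \<phi> A f \<longleftrightarrow> groupoid_diagram I r A f \<and>
     (\<exists>h. (\<forall>i\<in>I. h i \<in> iso_join0 (Con_c (A i)) (D i)) \<and>
          (\<forall>(i, j)\<in>r. \<forall>\<alpha>\<in>carrier (Con_c (A i)).
             h j (Con_c_map (A j) (f i j) \<alpha>) = \<phi> i j (h i \<alpha>)))"

end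

theory Submission
  imports Defs
begin

text \<open>Let \<open>F\<close> be a groupoid of terms with subgroupoids \<open>F i\<close>, increasing in \<open>i\<close>, and let \<open>\<delta> i\<close> be
  a distance on \<open>F i\<close> with values in \<open>D i\<close>, compatible with the product, taking all values, and
  natural in the sense that \<open>\<delta> j = \<phi> i j \<circ> \<delta> i\<close> on \<open>F i\<close>. If moreover
  \<open>\<delta> x y \<le> \<delta> s t \<squnion> \<delta> s' t'\<close> forces \<open>(x, y)\<close> into the congruence generated by \<open>(s, t)\<close>,
  \<open>(s', t')\<close> and the pairs at distance zero, then the compact congruences of \<open>F i\<close> modulo
  \<open>\<delta> i = 0\<close> are the relations \<open>\<delta> i \<le> d\<close>, and these quotients lift the diagram.

  Such a distance is built freely. As in Jonsson's representation of lattices by equivalence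
  relations, a pair with \<open>\<delta> x y \<le> b \<squnion> c\<close> is joined by a path with labels \<open>b, c, b, c\<close>; and for
  \<open>\<delta> x y = \<delta> s t\<close> two codes \<open>L, R\<close> are added with \<open>s \<cdot> L = x\<close>, \<open>t \<cdot> L = t \<cdot> R\<close>, \<open>s \<cdot> R = y\<close>, so that
  collapsing \<open>(s, t)\<close> collapses \<open>(x, y)\<close>. All other products are new elements. Distinct codes are at
  distance 1, which makes it harmless that unrelated codes act in unrelated ways: this is where
  the greatest element is needed. Instead of the distance itself one describes, for each proper
  ideal \<open>J\<close>, the relation \<open>\<delta> s t \<in> J\<close> as equality of normal forms; the distance exists because the
  set of ideals \<open>J\<close> identifying two given terms is always of the form \<open>{J. d \<in> J}\<close>.\<close>

section \<open>Terms and normal forms\<close>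

text \<open>The path attached to \<open>(x, y)\<close> runs \<open>x, P1, P2, P3, y\<close> with labels \<open>b, c, b, c\<close>. The tip \<open>P4\<close> is
  at distance zero from \<open>P2\<close>, but is assigned to \<open>y\<close> where \<open>P2\<close> is assigned to \<open>x\<close>.
  \<open>Code False x y s t\<close> and \<open>Code True x y s t\<close> are the codes \<open>L\<close> and \<open>R\<close>.\<close>

datatype tip = P1 | P2 | P3 | P4

datatype 'l tm =
    Org
  | Cell tip 'l 'l "'l tm" "'l tm"
  | Code bool "'l tm" "'l tm" "'l tm" "'l tm"
  | App "'l tm" "'l tm"

primrec sz :: "'l tm \<Rightarrow> nat" where
  "sz Org = 1"
| "sz (Cell m b c x y) = 1 + sz x + sz y"
| "sz (Code \<sigma> x y s t) = 1 + sz x + sz y + sz s + sz t"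
| "sz (App u v) = 1 + sz u + sz v"

text \<open>With \<open>p\<close> and \<open>q\<close> telling whether the labels \<open>b\<close> and \<open>c\<close> are collapsed, \<open>leaves m p q\<close> says that
  the tip \<open>m\<close> is identified with the end of the path on its side, and \<open>settle m p q\<close> is otherwise
  the tip representing its class.\<close>

primrec side :: "tip \<Rightarrow> bool" where
  "side P1 = False" | "side P2 = False" | "side P3 = True" | "side P4 = True"

primrec leaves :: "tip \<Rightarrow> bool \<Rightarrow> bool \<Rightarrow> bool" where
  "leaves P1 p q = p" | "leaves P2 p q = (p \<and> q)" | "leaves P3 p q = q" | "leaves P4 p q = (p \<and> q)"

definition settle :: "tip \<Rightarrow> bool \<Rightarrow> bool \<Rightarrow> tip" where
  "settle m p q = (if p then P3 else if q then P1 else if m = P4 then P2 else m)"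

text \<open>The head of \<open>gates v\<close> is the only code at distance less than 1 from \<open>v\<close>, if there is one. An
  element \<open>App u v\<close> is connected to the rest only through the end of that code, hence the tail.\<close>

primrec gates :: "'l tm \<Rightarrow> 'l tm list" where
  "gates Org = []"
| "gates (Cell m b c x y) = (if side m then gates y else gates x)"
| "gates (Code \<sigma> x y s t) = Code \<sigma> x y s t # (if \<sigma> then gates y else gates x)"
| "gates (App u v) = tl (gates v)"

fun dock :: "'l tm \<Rightarrow> 'l tm" where
  "dock (Code \<sigma> x y s t) = (if \<sigma> then y else x)"
| "dock v = v"

definition is_code :: "'l tm \<Rightarrow> bool" where
  "is_code v \<longleftrightarrow> (\<exists>\<sigma> x y s t. v = Code \<sigma> x y s t)"

lemma is_code_simps [simp]:
  "\<not> is_code Org" "\<not> is_code (Cell m b c x y)" "is_code (Code \<sigma> x y s t)" "\<not> is_code (App u v)"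
  by (auto simp: is_code_def)

text \<open>A product drops the head gate of its right factor, so the induction has to carry an
  arbitrary prefix \<open>k\<close> of gates already dropped.\<close>

lemma gates_suffix:
  "gates v = k @ c # l \<Longrightarrow> is_code c \<and> gates (dock c) = l"
proof (induction v arbitrary: k)
  case (Code \<sigma> x y s t)
  then show ?case
    by (cases k) (auto split: if_splits)
next
  case (App u v)
  then obtain d where "gates v = (d # k) @ c # l"
    by (cases "gates v") auto
  then show ?case
    by (rule App.IH(2))
qed (auto split: if_splits)

lemma gates_Cons: "gates v = c # l \<Longrightarrow> is_code c \<and> gates (dock c) = l"
  using gates_suffix[of v "[]"] by simp

lemma sz_gates: "c \<in> set (gates v) \<Longrightarrow> sz c \<le> sz v"
proof (induction v)
  case (App u v)
  then have "c \<in> set (gates v)"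
    by (cases "gates v") auto
  with App show ?case by simp
qed (auto split: if_splits)

lemma sz_dock: "is_code c \<Longrightarrow> sz (dock c) < sz c"
  by (auto simp: is_code_def)

lemma sz_gate_Cons: "gates v = c # l \<Longrightarrow> sz c \<le> sz v \<and> sz (dock c) < sz c"
  using gates_Cons[of v c l] sz_gates[of c v] sz_dock[of c] by simp

text \<open>The clause for products performs the rules for codes: \<open>u\<close> matching
  \<open>s\<close> gives the end of the code, and the flag
  \<open>\<sigma> \<and> nf P u \<noteq> nf P t\<close> replaces the code R by L once
  \<open>u\<close> matches \<open>t\<close>. If \<open>u\<close> matches both, the terms of
  \<open>tms\<close> defined below have \<open>x\<close> and \<open>y\<close> identified, so trying
  \<open>s\<close> first does no harm.\<close>

function nf :: "('l \<Rightarrow> bool) \<Rightarrow> 'l tm \<Rightarrow> 'l tm" where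
  "nf P Org = Org"
| "nf P (Cell m b c x y) =
    (if leaves m (P b) (P c) then nf P (if side m then y else x)
     else Cell (settle m (P b) (P c)) b c x y)"
| "nf P (Code \<sigma> x y s t) = Code \<sigma> x y s t"
| "nf P (App u v) =
    (case gates v of
       Code \<sigma> x y s t # _ \<Rightarrow>
         if nf P v = Code \<sigma> x y s t
         then if nf P u = nf P s then nf P (if \<sigma> then y else x)
              else App (nf P u) (Code (\<sigma> \<and> nf P u \<noteq> nf P t) x y s t)
         else App (nf P u) (nf P v)
     | _ \<Rightarrow> App (nf P u) (nf P v))"
  by pat_completeness auto
termination
  apply (relation "measure (\<lambda>(P, v). sz v)")
           apply (auto dest: sz_gate_Cons)
  done

text \<open>A term becomes a code only by being one, by leaving a cell, which keeps the gates on its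
  side, or by a product collapsing to the dock of the head gate of its right factor, whose gates are
  exactly the remaining ones.\<close>

lemma nf_code_gates: "is_code (nf P v) \<Longrightarrow> gates v = nf P v # gates (dock (nf P v))"
proof (induction "sz v" arbitrary: v rule: less_induct)
  case less
  show ?case
  proof (cases v)
    case (Cell m b c x y)
    then show ?thesis
      using less.prems less.hyps[of x] less.hyps[of y] by (auto split: if_splits)
  next
    case (App u w)
    have "gates w \<noteq> []"
      using less.prems App by auto
    then obtain c l where w: "gates w = c # l"
      by (cases "gates w") auto
    with gates_Cons obtain \<sigma> x y s t where c: "c = Code \<sigma> x y s t" and l: "gates (dock c) = l"
      unfolding is_code_def by metis
    from less.prems App w c have e: "nf P w = c" "nf P u = nf P s"
      by (auto split: if_splits)
    then have n: "nf P v = nf P (dock c)"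
      using App w c by simp
    have "sz (dock c) < sz v"
      using sz_gate_Cons[OF w] App by simp
    moreover have "gates v = gates (dock c)"
      using w l App by simp
    ultimately show ?thesis
      using less.hyps[of "dock c"] less.prems unfolding n by metis
  qed (use less.prems in auto)
qed

text \<open>The guard on \<open>gates\<close> in the definition of \<open>nf\<close> only serves termination.\<close>

lemma nf_App:
  "nf P (App u v) =
    (case nf P v of
       Code \<sigma> x y s t \<Rightarrow>
         if nf P u = nf P s then nf P (if \<sigma> then y else x)
         else App (nf P u) (Code (\<sigma> \<and> nf P u \<noteq> nf P t) x y s t)
     | _ \<Rightarrow> App (nf P u) (nf P v))"
proof (cases "is_code (nf P v)")
  case True
  then show ?thesis
    using nf_code_gates[OF True] by (auto simp: is_code_def)
next
  case False
  then show ?thesis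
    by (auto split: tm.splits list.splits)
qed

declare nf.simps(4) [simp del]

lemma nf_App_code:
  assumes "nf P v = Code \<sigma> x y s t"
  shows "nf P (App u v) =
    (if nf P u = nf P s then nf P (if \<sigma> then y else x)
     else App (nf P u) (Code (\<sigma> \<and> nf P u \<noteq> nf P t) x y s t))"
  using assms by (simp add: nf_App)

lemma nf_App_not_code: "\<not> is_code (nf P v) \<Longrightarrow> nf P (App u v) = App (nf P u) (nf P v)"
  by (cases "nf P v") (auto simp: nf_App)

lemma nf_App_cong:
  "nf P u = nf P u' \<Longrightarrow> nf P v = nf P v' \<Longrightarrow> nf P (App u v) = nf P (App u' v')"
  by (cases "nf P v'") (simp_all add: nf_App)

section \<open>Collapse at the root, and sizes of normal forms\<close>

fun exits :: "('l \<Rightarrow> bool) \<Rightarrow> 'l tm \<Rightarrow> bool" where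
  "exits P (Cell m b c x y) = leaves m (P b) (P c)"
| "exits P (App u v) = (\<exists>\<sigma> x y s t. nf P v = Code \<sigma> x y s t \<and> nf P u = nf P s)"
| "exits P _ = False"

text \<open>The smaller term to which a term may collapse, its \<open>foot\<close>, is fixed
  independently of \<open>P\<close>; only whether the collapse takes place depends on
  \<open>P\<close>, and this is \<open>exits\<close>.\<close>

fun hangs :: "'l tm \<Rightarrow> bool" where
  "hangs (Cell m b c x y) = True"
| "hangs (App u v) = (gates v \<noteq> [])"
| "hangs _ = False"

fun foot :: "'l tm \<Rightarrow> 'l tm" where
  "foot (Cell m b c x y) = (if side m then y else x)"
| "foot (App u v) = dock (hd (gates v))"
| "foot v = v"

lemma hangs_foot:
  assumes "hangs w"
  shows "sz (foot w) < sz w" and "gates (foot w) = gates w"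
proof (atomize (full), cases w)
  case (App u v)
  with assms obtain c l where "gates v = c # l"
    by (cases "gates v") auto
  then show "sz (foot w) < sz w \<and> gates (foot w) = gates w"
    using App sz_gate_Cons[of v c l] gates_Cons[of v c l] by auto
qed (use assms in auto)

lemma exits_hangs: "exits P w \<Longrightarrow> hangs w"
  by (cases w) (auto dest: nf_code_gates[of P] simp: is_code_def, metis is_code_simps(3) list.distinct(1) nf_code_gates)

lemma exits_nf: "exits P w \<Longrightarrow> nf P w = nf P (foot w)"
proof (cases w)
  case (App u v)
  assume "exits P w"
  with App obtain \<sigma> x y s t where v: "nf P v = Code \<sigma> x y s t" and u: "nf P u = nf P s"
    by auto
  have "hd (gates v) = Code \<sigma> x y s t"
    using nf_code_gates[of P v] v by simp
  then show ?thesis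
    using App u by (simp add: nf_App_code[OF v])
qed auto

lemma not_exits_App:
  "\<not> exits P (App u v) \<Longrightarrow> \<exists>q. nf P (App u v) = App (nf P u) q \<and> sz q = sz (nf P v)"
  by (cases "nf P v") (auto simp: nf_App)

lemma sz_nf: "sz (nf P v) \<le> sz v"
proof (induction "sz v" arbitrary: v rule: less_induct)
  case less
  show ?case
  proof (cases "exits P v")
    case True
    then show ?thesis
      using less hangs_foot[of v] exits_hangs[of P v] exits_nf[of P v] by fastforce
  next
    case False
    show ?thesis
    proof (cases v)
      case (App u w)
      then show ?thesis
        using False not_exits_App[of P u w] less[of u] less[of w] by auto
    qed (use False in auto)
  qed
qed

text \<open>Collapsing to the foot keeps the gates, and a cell that stays contains both ends. A
  product that stays contains, up to a flag, the normal form of its right factor; this is at least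
  as large as the head gate of that factor, hence larger than the gates behind it.\<close>

lemma sz_gate_le_nf: "gates v = c # l \<Longrightarrow> sz c \<le> sz (nf P v)"
proof (induction "sz v" arbitrary: v c l rule: less_induct)
  case less
  show ?case
  proof (cases "exits P v")
    case True
    then show ?thesis
      using less hangs_foot[of v] exits_hangs[of P v] exits_nf[of P v] by fastforce
  next
    case False
    show ?thesis
    proof (cases v)
      case (Cell m b k x y)
      then show ?thesis
        using False less.prems sz_gates[of c x] sz_gates[of c y] by (auto split: if_splits)
    next
      case (App u w)
      with less.prems obtain d l' where d: "gates w = d # l'" "l' = c # l"
        by (cases "gates w") auto
      have "sz d \<le> sz (nf P w)"
        using less.hyps[of w d l'] App d by simp
      moreover have "sz c \<le> sz (dock d)" "sz (dock d) < sz d"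
        using sz_gate_Cons[of w d l'] gates_Cons[of w d l'] sz_gate_Cons[of "dock d" c l] d by auto
      ultimately show ?thesis
        using App False not_exits_App[of P u w] by auto
    qed (use less.prems in auto)
  qed
qed

lemma sz_foot_less_nf:
  assumes "hangs w" "\<not> exits P w"
  shows "sz (foot w) < sz (nf P w)"
proof (cases w)
  case (App u v)
  with assms obtain c l where c: "gates v = c # l"
    by (cases "gates v") auto
  then show ?thesis
    using App assms not_exits_App[of P u v] sz_gate_Cons[of v c l] sz_gate_le_nf[of v c l P] by auto
qed (use assms in auto)

lemma sz_nf_foot_le: "hangs w \<Longrightarrow> sz (nf P (foot w)) \<le> sz (nf P w)"
  using sz_foot_less_nf[of w P] sz_nf[of P "foot w"] exits_nf[of P w] by fastforce

section \<open>Admissible terms and change of parameters\<close>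

text \<open>For a code the gates of \<open>x\<close> and \<open>y\<close> have to agree: otherwise two codes could both be close to
  \<open>App t L\<close> and \<open>App t R\<close>, and products with these elements would have no well-defined distance.
  The tip \<open>P4\<close> serves to split the path into steps that satisfy this.\<close>

inductive_set tms :: "'l set \<Rightarrow> ('l \<Rightarrow> bool) set \<Rightarrow> 'l tm set"
  for \<Lambda> :: "'l set" and \<P> :: "('l \<Rightarrow> bool) set" where
  Org: "Org \<in> tms \<Lambda> \<P>"
| Cell: "\<lbrakk>b \<in> \<Lambda>; c \<in> \<Lambda>; x \<in> tms \<Lambda> \<P>; y \<in> tms \<Lambda> \<P>;
    \<And>P. P \<in> \<P> \<Longrightarrow> P b \<Longrightarrow> P c \<Longrightarrow> nf P x = nf P y\<rbrakk> \<Longrightarrow> Cell m b c x y \<in> tms \<Lambda> \<P>"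
| Code: "\<lbrakk>x \<in> tms \<Lambda> \<P>; y \<in> tms \<Lambda> \<P>; s \<in> tms \<Lambda> \<P>; t \<in> tms \<Lambda> \<P>; gates x = gates y;
    \<And>P. P \<in> \<P> \<Longrightarrow> nf P s = nf P t \<longleftrightarrow> nf P x = nf P y\<rbrakk> \<Longrightarrow> Code \<sigma> x y s t \<in> tms \<Lambda> \<P>"
| App: "\<lbrakk>u \<in> tms \<Lambda> \<P>; v \<in> tms \<Lambda> \<P>\<rbrakk> \<Longrightarrow> App u v \<in> tms \<Lambda> \<P>"

inductive_cases tms_CellE: "Cell m b c x y \<in> tms \<Lambda> \<P>"
inductive_cases tms_CodeE: "Code \<sigma> x y s t \<in> tms \<Lambda> \<P>"
inductive_cases tms_AppE: "App u v \<in> tms \<Lambda> \<P>"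

lemma gates_tms: "v \<in> tms \<Lambda> \<P> \<Longrightarrow> set (gates v) \<subseteq> tms \<Lambda> \<P>"
proof (induction v rule: tms.induct)
  case (App u v)
  then show ?case by (cases "gates v") auto
qed (auto intro: tms.Code)

lemma dock_tms: "c \<in> tms \<Lambda> \<P> \<Longrightarrow> dock c \<in> tms \<Lambda> \<P>"
  by (cases c) (auto elim: tms_CodeE)

lemma foot_tms: "w \<in> tms \<Lambda> \<P> \<Longrightarrow> hangs w \<Longrightarrow> foot w \<in> tms \<Lambda> \<P>"
  using gates_tms
  by (cases w) (fastforce elim!: tms_CellE tms_AppE intro: dock_tms)+

text \<open>All labels that normalisation consults lie in \<open>\<Lambda>\<close>; for a product
  these include labels inside the head gate of the right factor, which belongs to \<open>tms\<close>
  as well.\<close>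

lemma nf_cong:
  assumes "v \<in> tms \<Lambda> \<P>" "\<And>b. b \<in> \<Lambda> \<Longrightarrow> P b = Q b"
  shows "nf P v = nf Q v"
  using assms(1)
proof (induction "sz v" arbitrary: v rule: less_induct)
  case less
  show ?case
  proof (cases v)
    case (Cell m b c x y)
    then have "b \<in> \<Lambda>" "c \<in> \<Lambda>" "x \<in> tms \<Lambda> \<P>" "y \<in> tms \<Lambda> \<P>"
      using less.prems by (auto elim: tms_CellE)
    then show ?thesis
      using less.hyps[of x] less.hyps[of y] Cell assms(2) by simp
  next
    case (App u w)
    then have uw: "u \<in> tms \<Lambda> \<P>" "w \<in> tms \<Lambda> \<P>"
      using less.prems by (auto elim: tms_AppE)
    then have eq: "nf P u = nf Q u" "nf P w = nf Q w"
      using less.hyps App by simp_all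
    show ?thesis
    proof (cases "is_code (nf P w)")
      case False
      then show ?thesis
        using eq App by (simp add: nf_App_not_code)
    next
      case True
      then obtain \<sigma> x y s t where c: "nf P w = Code \<sigma> x y s t"
        by (auto simp: is_code_def)
      then have g: "gates w = Code \<sigma> x y s t # gates (if \<sigma> then y else x)"
        using nf_code_gates[OF True] by simp
      then have "Code \<sigma> x y s t \<in> tms \<Lambda> \<P>"
        using gates_tms[OF uw(2)] by simp
      then have "x \<in> tms \<Lambda> \<P>" "y \<in> tms \<Lambda> \<P>" "s \<in> tms \<Lambda> \<P>" "t \<in> tms \<Lambda> \<P>"
        by (auto elim: tms_CodeE)
      moreover have "sz x < sz v" "sz y < sz v" "sz s < sz v" "sz t < sz v"
        using sz_gate_Cons[OF g] App by auto
      ultimately have "nf P x = nf Q x" "nf P y = nf Q y" "nf P s = nf Q s" "nf P t = nf Q t"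
        using less.hyps by blast+
      then show ?thesis
        using App eq c nf_App_code[of P w \<sigma> x y s t u] nf_App_code[of Q w \<sigma> x y s t u] by simp
    qed
  qed auto
qed

text \<open>The side conditions on cells and codes range over \<open>\<P>\<close>. Every new
  parameter acts on old terms like some old one, so the conditions persist; this yields the
  inclusions between the term groupoids along the poset.\<close>

lemma tms_mono:
  assumes "\<Lambda> \<subseteq> \<Lambda>'" "\<And>P. P \<in> \<P>' \<Longrightarrow> \<exists>Q\<in>\<P>. \<forall>b\<in>\<Lambda>. P b = Q b"
  shows "tms \<Lambda> \<P> \<subseteq> tms \<Lambda>' \<P>'"
proof
  fix v assume "v \<in> tms \<Lambda> \<P>"
  then show "v \<in> tms \<Lambda>' \<P>'"
  proof (induction v rule: tms.induct)
    case (Cell b c x y m)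
    have "nf P x = nf P y" if P: "P \<in> \<P>'" "P b" "P c" for P
    proof -
      obtain Q where Q: "Q \<in> \<P>" "\<forall>b\<in>\<Lambda>. P b = Q b"
        using assms(2) P(1) by blast
      then show ?thesis
        using Cell P nf_cong[of x \<Lambda> \<P> P Q] nf_cong[of y \<Lambda> \<P> P Q] by simp
    qed
    then show ?case
      using Cell assms(1) by (intro tms.Cell) auto
  next
    case (Code x y s t \<sigma>)
    have "nf P s = nf P t \<longleftrightarrow> nf P x = nf P y" if "P \<in> \<P>'" for P
    proof -
      obtain Q where Q: "Q \<in> \<P>" "\<And>b. b\<in>\<Lambda> \<Longrightarrow> P b = Q b"
        using assms(2) \<open>P \<in> \<P>'\<close> by blast
      have "nf P z = nf Q z" if "z \<in> tms \<Lambda> \<P>" for z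
        using that Q(2) by (rule nf_cong)
      then show ?thesis
        using Code Q(1) by simp
    qed
    then show ?case
      using Code by (intro tms.Code) auto
  qed (auto intro: tms.intros)
qed

section \<open>Principality of identification\<close>

definition tag :: "('l \<Rightarrow> bool) \<Rightarrow> 'l tm \<Rightarrow> 'l tm \<Rightarrow> 'l tm" where
  "tag P u v = (case nf P v of
     Code \<sigma> x y s t \<Rightarrow> Code (\<sigma> \<and> nf P u \<noteq> nf P t) x y s t | q \<Rightarrow> q)"

lemma nf_App_tag: "\<not> exits P (App u v) \<Longrightarrow> nf P (App u v) = App (nf P u) (tag P u v)"
  by (cases "nf P v") (auto simp: nf_App tag_def)

text \<open>The flag over \<open>t\<close> is the only information about its right factor that the
  right component \<open>tag\<close> can lose.\<close>

lemma tag_eqD: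
  assumes "nf P u = nf P u'" "tag P u v = tag P u' v'"
  shows "nf P v = nf P v' \<or> (\<exists>\<sigma> x y s t. nf P v = Code \<sigma> x y s t \<and>
    nf P v' = Code (\<not> \<sigma>) x y s t \<and> nf P u = nf P t)"
  using assms by (cases "nf P v"; cases "nf P v'") (auto simp: tag_def)

text \<open>An element \<open>v\<close> that is close to its gate for \<open>Q\<close> and close for \<open>P\<close> to an element \<open>v'\<close> with
  another gate: then \<open>v'\<close> cannot be close to anything as old as the gate of \<open>v\<close> for \<open>Q\<close>. This excludes
  competing shortest paths, whose length would be a meet.\<close>

lemma separation:
  assumes "v \<in> tms \<Lambda> \<P>" "v' \<in> tms \<Lambda> \<P>" "P \<in> \<P>" "Q \<in> \<P>"
    and "is_code (nf Q v)" "nf P v = nf P v'" "gates v' \<noteq> gates v"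
  shows "sz (nf Q v) < sz (nf Q v')"
  using assms(1,2,5-)
proof (induction "sz v + sz v'" arbitrary: v v' rule: less_induct)
  case less
  note gate = nf_code_gates[OF less.prems(3)]
  \<comment> \<open>Otherwise \<open>v\<close> is itself a code, hence its own normal form for
    \<open>P\<close>, hence the head gate of \<open>v'\<close>, and the gates of \<open>v\<close>
    and \<open>v'\<close> agree.\<close>
  have "exits Q v"
  proof (rule ccontr)
    assume "\<not> exits Q v"
    with less.prems(3) not_exits_App[of Q] have "is_code v"
      by (cases v) (fastforce split: if_splits)+
    then have "nf P v' = v"
      using less.prems(4) by (auto simp: is_code_def)
    then show False
      using nf_code_gates[of P v'] nf_code_gates[of P v] \<open>is_code v\<close> less.prems by simp
  qed
  then have Qv: "nf Q v = nf Q (foot v)" and hv: "hangs v"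
    using exits_nf exits_hangs by blast+
  show ?case
  proof (cases "exits P v'")
    case True
    then have h: "hangs v'" and "nf P v' = nf P (foot v')"
      using exits_nf exits_hangs by blast+
    then have "sz (nf Q v) < sz (nf Q (foot v'))"
      using less.hyps[of v "foot v'"] hangs_foot[OF h] foot_tms[OF less.prems(2) h] less.prems by simp
    with sz_nf_foot_le[OF h] show ?thesis
      by (meson less_le_trans)
  next
    case stuck': False
    show ?thesis
    proof (cases "exits P v")
      case True
      then have "nf P v = nf P (foot v)"
        by (rule exits_nf)
      then show ?thesis
        using less.hyps[of "foot v" v'] hangs_foot[OF hv] foot_tms[OF less.prems(1) hv] less.prems Qv
        by simp
    next
      case stuck: False
      show ?thesis
      proof (cases v)
        case (Cell m b c x y)
        have "\<exists>m'. v' = Cell m' b c x y"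
          using less.prems(4) stuck stuck' Cell not_exits_App[of P] by (cases v') fastforce+
        then obtain m' where v': "v' = Cell m' b c x y" ..
        with less.prems(5) Cell have sides: "side m' \<noteq> side m" "gates x \<noteq> gates y"
          by (auto split: if_splits)
        \<comment> \<open>With both labels collapsed the two ends would be identified with one code,
          which determines the gates of each of them.\<close>
        have "\<not> (Q b \<and> Q c)"
        proof
          assume bc: "Q b \<and> Q c"
          then have "nf Q x = nf Q y"
            using less.prems(1) Cell \<open>Q \<in> \<P>\<close> by (auto elim: tms_CellE)
          then show False
            using Qv less.prems(3) Cell nf_code_gates[of Q x] nf_code_gates[of Q y] sides(2)
            by (auto split: if_splits)
        qed
        then have "\<not> leaves m' (Q b) (Q c)"
          using \<open>exits Q v\<close> Cell sides(1) by (cases m; cases m') auto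
        then have "sz (nf Q v') = 1 + sz x + sz y"
          using v' by simp
        moreover have "sz (nf Q v) \<le> sz x + sz y"
          using Qv Cell sz_nf[of Q x] sz_nf[of Q y] by (auto split: if_splits)
        ultimately show ?thesis by simp
      next
        case (App p q)
        have "\<exists>p' q'. v' = App p' q'"
          using less.prems(4) stuck stuck' App not_exits_App[of P p q] by (cases v') fastforce+
        then obtain p' q' where v': "v' = App p' q'" by blast
        have T: "p \<in> tms \<Lambda> \<P>" "q \<in> tms \<Lambda> \<P>" "p' \<in> tms \<Lambda> \<P>" "q' \<in> tms \<Lambda> \<P>"
          using less.prems App v' by (auto elim: tms_AppE)
        from \<open>exits Q v\<close> App obtain \<sigma> x y s t where q: "nf Q q = Code \<sigma> x y s t"
          by auto
        then have gq: "gates q = Code \<sigma> x y s t # gates (if \<sigma> then y else x)"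
          using nf_code_gates[of Q q] by simp
        have gqq': "gates q' \<noteq> gates q"
          using less.prems(5) App v' by auto
        have eq: "nf P p = nf P p'" "tag P p q = tag P p' q'"
          using less.prems(4) App v' nf_App_tag[of P p q] nf_App_tag[of P p' q'] stuck stuck' by auto
        \<comment> \<open>The alternative is a pair of opposite codes. Their ends have equal gates,
          by the condition imposed on codes, so \<open>v\<close> and \<open>v'\<close> would have
          equal gates too.\<close>
        have qq': "nf P q = nf P q'"
        proof (rule ccontr)
          assume "nf P q \<noteq> nf P q'"
          with tag_eqD[OF eq] obtain \<rho> x1 y1 s1 t1 where
            *: "nf P q = Code \<rho> x1 y1 s1 t1" "nf P q' = Code (\<not> \<rho>) x1 y1 s1 t1"
            by blast
          then have g: "gates q = Code \<rho> x1 y1 s1 t1 # gates (if \<rho> then y1 else x1)"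
            "gates q' = Code (\<not> \<rho>) x1 y1 s1 t1 # gates (if \<rho> then x1 else y1)"
            using nf_code_gates[of P q] nf_code_gates[of P q'] by auto
          then have "Code \<rho> x1 y1 s1 t1 \<in> tms \<Lambda> \<P>"
            using gates_tms[OF T(2)] by simp
          then have "gates x1 = gates y1"
            by (auto elim: tms_CodeE)
          then show False
            using g less.prems(5) App v' by (auto split: if_splits)
        qed
        have small: "sz q + sz q' < sz v + sz v'"
          using App v' by simp
        have less1: "sz (nf Q q) < sz (nf Q q')"
          using less.hyps[OF small T(2,4) _ qq' gqq'] q by simp
        \<comment> \<open>An exit would make \<open>nf Q q'\<close> a code, and the induction
          hypothesis with \<open>q\<close> and \<open>q'\<close> exchanged would reverse the
          inequality just obtained.\<close>
        have "\<not> exits Q v'"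
        proof
          assume "exits Q v'"
          then have "is_code (nf Q q')"
            using v' by auto
          then have "sz (nf Q q') < sz (nf Q q)"
            using less.hyps[of q' q] small T qq' gqq' by simp
          with less1 show False by simp
        qed
        then have "sz (nf Q q') < sz (nf Q v')"
          using not_exits_App[of Q p' q'] v' by auto
        moreover have "sz (nf Q v) < sz (nf Q q)"
        proof -
          have "foot v = (if \<sigma> then y else x)"
            using App gq by simp
          then show ?thesis
            using Qv q sz_nf[of Q x] sz_nf[of Q y] by auto
        qed
        ultimately show ?thesis
          using less1 by simp
      qed (use hv in auto)
    qed
  qed
qed

section \<open>Which of two terms exits first\<close>

text \<open>A lower bound for the size of the normal form of a term that does not exit; of two terms with
  equal normal forms, the bulkier one has to exit first.\<close>

fun bulk :: "'l tm \<Rightarrow> nat" where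
  "bulk (App u v) = Suc (sz (hd (gates v)))"
| "bulk v = sz v"

lemma foot_less_bulk: "hangs w \<Longrightarrow> sz (foot w) < bulk w"
proof (cases w)
  case (App u v)
  assume "hangs w"
  with App obtain c l where "gates v = c # l"
    by (cases "gates v") auto
  then show ?thesis
    using App sz_gate_Cons[of v c l] by simp
qed auto

lemma bulk_le_nf: "hangs w \<Longrightarrow> \<not> exits P w \<Longrightarrow> bulk w \<le> sz (nf P w)"
proof (cases w)
  case (App u v)
  assume "hangs w" "\<not> exits P w"
  with App obtain c l where "gates v = c # l"
    by (cases "gates v") auto
  then show ?thesis
    using App not_exits_App[of P u v] \<open>\<not> exits P w\<close> sz_gate_le_nf[of v c l P] by auto
qed auto

lemma exits_dominance:
  assumes "hangs w" "hangs w'" "bulk w' \<le> bulk w" "nf P w = nf P w'" "exits P w'"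
  shows "exits P w"
proof (rule ccontr)
  assume "\<not> exits P w"
  then have "bulk w \<le> sz (nf P w)"
    using assms(1) bulk_le_nf by blast
  also have "\<dots> = sz (nf P (foot w'))"
    using assms exits_nf by metis
  also have "\<dots> \<le> sz (foot w')"
    by (rule sz_nf)
  also have "\<dots> < bulk w'"
    using assms(2) by (rule foot_less_bulk)
  finally show False
    using assms(3) by simp
qed

lemma exits_App_gate:
  "gates v = Code \<sigma> x y s t # l \<Longrightarrow>
    exits P (App u v) \<longleftrightarrow> nf P v = Code \<sigma> x y s t \<and> nf P u = nf P s"
  using nf_code_gates[of P v] by (metis exits.simps(2) is_code_simps(3) list.inject tm.inject(2))

lemma not_exits_shape:
  assumes "\<not> exits P w"
  shows "case w of Cell m b c x y \<Rightarrow> \<exists>m'. nf P w = Cell m' b c x y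
    | App u v \<Rightarrow> nf P w = App (nf P u) (tag P u v) | _ \<Rightarrow> nf P w = w"
  using assms by (cases w) (simp_all add: nf_App_tag del: exits.simps(2))

text \<open>The induction for \<open>prin_eqv\<close> also descends to pairs taken from inside a
  single one of the two terms. This can increase the sum of the sizes, but it decreases the sum of
  the powers of two.\<close>

lemma two_power_lt:
  "a < m \<Longrightarrow> b < m \<Longrightarrow> 2 ^ a + 2 ^ b < (2 :: nat) ^ m + 2 ^ n"
proof -
  assume "a < m" "b < m"
  then obtain k where k: "m = Suc k" "a \<le> k" "b \<le> k"
    by (cases m) auto
  then have "(2::nat) ^ a \<le> 2 ^ k" "(2::nat) ^ b \<le> 2 ^ k"
    by (simp_all add: power_increasing)
  moreover have "(0::nat) < 2 ^ n"
    by simp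
  ultimately show ?thesis
    unfolding k power_Suc by linarith
qed

section \<open>Principal conditions\<close>

text \<open>\<open>prin H\<close> abstracts the existence of \<open>d\<close> such that \<open>H\<close> holds for \<open>J\<close> exactly if \<open>d \<in> J\<close>, with an
  ideal \<open>J\<close> represented by the set of labels collapsed by it.\<close>

locale principal =
  fixes \<Lambda> :: "'l set" and \<P> :: "('l \<Rightarrow> bool) set" and prin :: "(('l \<Rightarrow> bool) \<Rightarrow> bool) \<Rightarrow> bool"
  assumes prin_cong: "\<lbrakk>prin F; \<And>P. P \<in> \<P> \<Longrightarrow> F P \<longleftrightarrow> G P\<rbrakk> \<Longrightarrow> prin G"
    and prin_True: "prin (\<lambda>_. True)"
    and prin_False: "prin (\<lambda>_. False)"
    and prin_conj: "\<lbrakk>prin F; prin G\<rbrakk> \<Longrightarrow> prin (\<lambda>P. F P \<and> G P)"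
    and prin_label: "b \<in> \<Lambda> \<Longrightarrow> prin (\<lambda>P. P b)"
begin

abbreviation "T \<equiv> tms \<Lambda> \<P>"

abbreviation eqv :: "'l tm \<Rightarrow> 'l tm \<Rightarrow> ('l \<Rightarrow> bool) \<Rightarrow> bool" where
  "eqv v w \<equiv> \<lambda>P. nf P v = nf P w"

text \<open>A cell exits under a conjunction of label conditions. A product exits if two equalities
  hold between terms smaller than itself: the right factor equals its head gate, and the left factor
  equals the \<open>s\<close> of that gate.\<close>

lemma prin_exits:
  assumes "w \<in> T" "hangs w"
    and IH: "\<And>a b. a \<in> T \<Longrightarrow> b \<in> T \<Longrightarrow> sz a < sz w \<Longrightarrow> sz b < sz w \<Longrightarrow> prin (eqv a b)"
  shows "prin (\<lambda>P. exits P w)"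
proof (cases w)
  case (Cell m b c x y)
  then have "prin (\<lambda>P. P b)" "prin (\<lambda>P. P c)"
    using assms(1) prin_label by (auto elim: tms_CellE)
  with prin_conj[of "\<lambda>P. P b" "\<lambda>P. P c"] show ?thesis
    unfolding Cell by (cases m) simp_all
next
  case (App u v)
  with assms(2) obtain c l where c: "gates v = c # l"
    by (cases "gates v") auto
  with gates_Cons[OF c] obtain \<sigma> x y s t where code: "c = Code \<sigma> x y s t"
    by (auto simp: is_code_def)
  have uv: "u \<in> T" "v \<in> T"
    using assms(1) App by (auto elim: tms_AppE)
  then have cT: "c \<in> T"
    using gates_tms[of v] c by auto
  then have "s \<in> T"
    using code by (auto elim: tms_CodeE)
  moreover have "sz c \<le> sz v" "sz s < sz c"
    using sz_gate_Cons[OF c] code by auto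
  ultimately have "prin (eqv v c)" "prin (eqv u s)"
    using IH[of v c] IH[of u s] uv cT App by auto
  then have "prin (\<lambda>P. nf P v = nf P c \<and> nf P u = nf P s)"
    by (rule prin_conj)
  then show ?thesis
    unfolding App using exits_App_gate[OF c[unfolded code]] code by simp
qed (use assms in auto)

text \<open>Principal conditions are closed under conjunction but in general not under disjunction.
  Hence in each case one has to find a single way in which the two terms can become equal, the same
  for all \<open>P\<close>, and to write it as a conjunction of conditions on smaller pairs.\<close>

lemma prin_eqv:
  assumes "w \<in> T" "w' \<in> T"
  shows "prin (eqv w w')"
  using assms
proof (induction "2 ^ sz w + 2 ^ sz w' :: nat" arbitrary: w w' rule: less_induct)
  case less
  note T = less.prems
  have IH: "prin (eqv a b)"
    if "a \<in> T" "b \<in> T" "sz a < sz w \<and> sz b < sz w \<or> sz a < sz w' \<and> sz b < sz w' \<or>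
      sz a < sz w \<and> sz b \<le> sz w' \<or> sz a \<le> sz w \<and> sz b < sz w'" for a b
  proof -
    have mono: "(2::nat) ^ i \<le> 2 ^ j" if "i \<le> j" for i j :: nat
      using that by (simp add: power_increasing)
    have smono: "(2::nat) ^ i < 2 ^ j" if "i < j" for i j :: nat
      using that by simp
    have "(2::nat) ^ sz a + 2 ^ sz b < 2 ^ sz w + 2 ^ sz w'"
      using that(3) two_power_lt[of "sz a" "sz w" "sz b" "sz w'"] two_power_lt[of "sz a" "sz w'" "sz b" "sz w"]
        mono[of "sz a" "sz w"] mono[of "sz b" "sz w'"] smono[of "sz a" "sz w"] smono[of "sz b" "sz w'"]
      by linarith
    then show ?thesis
      using less.hyps that by blast
  qed
  have left: "prin (eqv w w')"
    if "hangs w" "\<And>P. P \<in> \<P> \<Longrightarrow> nf P w = nf P w' \<Longrightarrow> exits P w"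
  proof -
    have "prin (\<lambda>P. exits P w)"
      using prin_exits[OF T(1) that(1)] IH by blast
    moreover have "prin (eqv (foot w) w')"
      using IH[of "foot w" w'] foot_tms[OF T(1) that(1)] hangs_foot(1)[OF that(1)] T by simp
    ultimately have "prin (\<lambda>P. exits P w \<and> nf P (foot w) = nf P w')"
      by (rule prin_conj)
    then show ?thesis
      by (rule prin_cong) (use that(2) exits_nf in metis)
  qed
  have right: "prin (eqv w w')"
    if "hangs w'" "\<And>P. P \<in> \<P> \<Longrightarrow> nf P w = nf P w' \<Longrightarrow> exits P w'"
  proof -
    have "prin (\<lambda>P. exits P w')"
      using prin_exits[OF T(2) that(1)] IH by blast
    moreover have "prin (eqv w (foot w'))"
      using IH[of w "foot w'"] foot_tms[OF T(2) that(1)] hangs_foot(1)[OF that(1)] T by simp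
    ultimately have "prin (\<lambda>P. exits P w' \<and> nf P w = nf P (foot w'))"
      by (rule prin_conj)
    then show ?thesis
      by (rule prin_cong) (use that(2) exits_nf in metis)
  qed
  have never: "prin (eqv w w')" if "\<And>P. P \<in> \<P> \<Longrightarrow> nf P w \<noteq> nf P w'"
    using prin_False by (rule prin_cong) (use that in simp)
  \<comment> \<open>The bulks do not involve \<open>P\<close>, so dominance selects one side that
    exits for all \<open>P\<close> at once and turns the disjunction into a single
    condition.\<close>
  have both: "prin (eqv w w')"
    if h: "hangs w" "hangs w'"
      and *: "\<And>P. P \<in> \<P> \<Longrightarrow> nf P w = nf P w' \<Longrightarrow> exits P w \<or> exits P w'"
  proof (cases "bulk w' \<le> bulk w")
    case True
    show ?thesis
      using left[OF h(1)] exits_dominance[OF h True] * by blast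
  next
    case False
    then have "bulk w \<le> bulk w'" by simp
    then show ?thesis
      using right[OF h(2)] exits_dominance[OF h(2,1)] * by metis
  qed
  consider (atom') "w' = Org \<or> is_code w'" | (atom) "w = Org \<or> is_code w"
    | (CC) m b c x y m' b' c' x' y' where "w = Cell m b c x y" "w' = Cell m' b' c' x' y'"
    | (CA) m b c x y u v where "w = Cell m b c x y" "w' = App u v"
    | (AC) m b c x y u v where "w' = Cell m b c x y" "w = App u v"
    | (AA) u v u' v' where "w = App u v" "w' = App u' v'"
    by (cases w; cases w') auto
  then show ?case
  proof cases
    case atom'
    then have w': "nf P w' = w'" for P
      by (auto simp: is_code_def)
    show ?thesis
    proof (cases "hangs w")
      case True
      show ?thesis
        using True by (rule left) (use w' atom' True not_exits_shape[of _ w] in \<open>cases w; fastforce\<close>)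
    next
      case False
      then have "\<not> exits P w" for P
        using exits_hangs by blast
      note shape = not_exits_shape[OF this]
      show ?thesis
      proof (cases "w = w'")
        case True
        then show ?thesis
          using prin_True by (auto elim: prin_cong)
      next
        case False
        then show ?thesis
          using w' atom' \<open>\<not> hangs w\<close> shape by (intro never) (cases w; fastforce)
      qed
    qed
  next
    case atom
    then have w: "nf P w = w" for P
      by (auto simp: is_code_def)
    show ?thesis
    proof (cases "hangs w'")
      case True
      show ?thesis
        using True by (rule right) (use w atom True not_exits_shape[of _ w'] in \<open>cases w'; fastforce\<close>)
    next
      case False
      then have "\<not> exits P w'" for P
        using exits_hangs by blast
      note shape = not_exits_shape[OF this]
      show ?thesis
      proof (cases "w = w'")
        case True
        then show ?thesis
          using prin_True by (auto elim: prin_cong)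
      next
        case False
        then show ?thesis
          using w atom \<open>\<not> hangs w'\<close> shape by (intro never) (cases w'; fastforce)
      qed
    qed
  next
    case CC
    show ?thesis
    proof (cases "b' = b \<and> c' = c \<and> x' = x \<and> y' = y")
      case True
      have Tw: "b \<in> \<Lambda>" "c \<in> \<Lambda>" and xy: "\<And>P. P \<in> \<P> \<Longrightarrow> P b \<Longrightarrow> P c \<Longrightarrow> nf P x = nf P y"
        using T CC by (auto elim: tms_CellE)
      have ne: "nf P x \<noteq> Cell k b c x y" "nf P y \<noteq> Cell k b c x y" for P k
        using sz_nf[of P x] sz_nf[of P y] by auto
      note ne' = ne[symmetric]
      note prins = prin_True prin_label[OF Tw(1)] prin_label[OF Tw(2)]
        prin_conj[OF prin_label[OF Tw(1)] prin_label[OF Tw(2)]]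
      obtain F where "prin F" "\<And>P. P \<in> \<P> \<Longrightarrow> F P \<longleftrightarrow> nf P w = nf P w'"
      proof
        \<comment> \<open>Two tips of one cell are identified exactly if the labels on the path
          between them are collapsed: \<open>c\<close> between \<open>P1\<close> and
          \<open>P2\<close>, \<open>b\<close> between \<open>P2\<close> and \<open>P3\<close>, and
          none between \<open>P2\<close> and \<open>P4\<close>.\<close>
        define F where "F = (\<lambda>P. (m = P1 \<and> m' \<in> {P2, P4} \<or> m \<in> {P2, P4} \<and> m' = P1 \<longrightarrow> P c) \<and>
          (m = P3 \<and> m' \<in> {P2, P4} \<or> m \<in> {P2, P4} \<and> m' = P3 \<longrightarrow> P b) \<and>
          (m = P1 \<and> m' = P3 \<or> m = P3 \<and> m' = P1 \<longrightarrow> P b \<and> P c))"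
        show "prin F"
          unfolding F_def using prins by (cases m; cases m') simp_all
        show "F P \<longleftrightarrow> nf P w = nf P w'" if "P \<in> \<P>" for P
          using CC True xy[OF that] ne ne'
          by (cases m; cases m'; cases "P b"; cases "P c") (simp_all add: F_def settle_def)
      qed
      then show ?thesis
        by (rule prin_cong)
    next
      case False
      then show ?thesis
        using CC not_exits_shape[of _ w] not_exits_shape[of _ w'] by (intro both) fastforce+
    qed
  next
    case CA
    show ?thesis
    proof (cases "hangs w'")
      case True
      then show ?thesis
        using CA not_exits_shape[of _ w] not_exits_shape[of _ w'] by (intro both) fastforce+
    next
      case False
      then have "\<not> exits P w'" for P
        using exits_hangs by blast
      then show ?thesis
        using CA not_exits_shape[of _ w] not_exits_shape[of _ w'] by (intro left) fastforce+
    qed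
  next
    case AC
    show ?thesis
    proof (cases "hangs w")
      case True
      then show ?thesis
        using AC not_exits_shape[of _ w] not_exits_shape[of _ w'] by (intro both) fastforce+
    next
      case False
      then have "\<not> exits P w" for P
        using exits_hangs by blast
      then show ?thesis
        using AC not_exits_shape[of _ w] not_exits_shape[of _ w'] by (intro right) fastforce+
    qed
  next
    case AA
    have uv: "u \<in> T" "v \<in> T" "u' \<in> T" "v' \<in> T"
      using T AA by (auto elim: tms_AppE)
    have ex: "exits P w \<longleftrightarrow> (\<exists>\<sigma> x y s t. nf P v = Code \<sigma> x y s t \<and> nf P u = nf P s)"
      "exits P w' \<longleftrightarrow> (\<exists>\<sigma> x y s t. nf P v' = Code \<sigma> x y s t \<and> nf P u' = nf P s)" for P
      using AA by simp_all
    define dir where "dir = (\<lambda>P. nf P u = nf P u' \<and> nf P v = nf P v')"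
    define opp where "opp = (\<lambda>P. \<exists>\<sigma> x y s t. nf P v = Code \<sigma> x y s t \<and>
      nf P v' = Code (\<not> \<sigma>) x y s t \<and> nf P u = nf P t \<and> nf P u' = nf P t)"
    have prin_dir: "prin dir"
      unfolding dir_def using uv AA by (intro prin_conj IH) auto
    have dirD: "nf P w = nf P w'" if "dir P" for P
      using that AA nf_App_cong unfolding dir_def by blast
    have stuckD: "dir P \<or> opp P" if "\<not> exits P w" "\<not> exits P w'" "nf P w = nf P w'" for P
    proof -
      have "nf P u = nf P u'" "tag P u v = tag P u' v'"
        using that AA not_exits_shape[of P w] not_exits_shape[of P w'] by auto
      with tag_eqD[OF this] show ?thesis
        unfolding dir_def opp_def by metis
    qed
    have oppD: "\<exists>\<sigma> x y s t l l'. gates v = Code \<sigma> x y s t # l \<and> gates v' = Code (\<not> \<sigma>) x y s t # l'"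
      if "opp P" for P
      using that nf_code_gates[of P v] nf_code_gates[of P v'] unfolding opp_def by fastforce
    show ?thesis
    proof (cases "gates v = gates v'")
      case True
      \<comment> \<open>Equal gates give equal bulks, so dominance works in both directions.\<close>
      have same: "exits P w \<longleftrightarrow> exits P w'" if "nf P w = nf P w'" for P
        using exits_dominance[of w w' P] exits_dominance[of w' w P] exits_hangs[of P w]
          exits_hangs[of P w'] that True AA by auto
      have "dir P" if "nf P w = nf P w'" for P
      proof (cases "exits P w")
        case e: True
        then have "is_code (nf P v)" "is_code (nf P v')"
          using same[OF that] ex by auto
        then have "nf P v = nf P v'"
          using True nf_code_gates[of P v] nf_code_gates[of P v'] by simp
        then show ?thesis
          using e same[OF that] ex unfolding dir_def by auto
      next
        case False
        then have "dir P \<or> opp P"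
          using stuckD same that by blast
        then show ?thesis
          using oppD[of P] True by auto
      qed
      with dirD have "dir P \<longleftrightarrow> nf P w = nf P w'" for P
        by blast
      with prin_dir show ?thesis
        by (rule prin_cong)
    next
      case gne: False
      show ?thesis
      proof (cases "\<exists>P\<in>\<P>. dir P")
        case True
        then obtain P0 where P0: "P0 \<in> \<P>" "nf P0 v = nf P0 v'"
          unfolding dir_def by blast
        \<comment> \<open>If \<open>w\<close> exits for \<open>Q\<close>, separation makes
          \<open>nf Q v\<close> smaller than \<open>nf Q v'\<close>. Then \<open>w'\<close> stays
          and its normal form is larger than \<open>nf Q v'\<close>, whereas that of
          \<open>w\<close> is smaller than \<open>nf Q v\<close>. The exchanged case is alike, and
          \<open>opp\<close> would give both strict inequalities.\<close>
        have "dir Q" if Q: "Q \<in> \<P>" "nf Q w = nf Q w'" for Q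
        proof -
          have sep: "is_code (nf Q v) \<Longrightarrow> sz (nf Q v) < sz (nf Q v')"
            "is_code (nf Q v') \<Longrightarrow> sz (nf Q v') < sz (nf Q v)"
            using separation[OF uv(2,4) P0(1) Q(1)] separation[OF uv(4,2) P0(1) Q(1)] P0(2) gne by auto
          have foot: "nf Q w = nf Q (foot w)" "sz (foot w) < sz (nf Q v)" "is_code (nf Q v)" if "exits Q w"
          proof -
            show "nf Q w = nf Q (foot w)"
              using that by (rule exits_nf)
            show code: "is_code (nf Q v)"
              using that ex by auto
            show "sz (foot w) < sz (nf Q v)"
              using nf_code_gates[OF code] sz_dock[OF code] AA by simp
          qed
          have foot': "nf Q w' = nf Q (foot w')" "sz (foot w') < sz (nf Q v')" "is_code (nf Q v')" if "exits Q w'"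
          proof -
            show "nf Q w' = nf Q (foot w')"
              using that by (rule exits_nf)
            show code: "is_code (nf Q v')"
              using that ex by auto
            show "sz (foot w') < sz (nf Q v')"
              using nf_code_gates[OF code] sz_dock[OF code] AA by simp
          qed
          have "\<not> exits Q w"
          proof
            assume e: "exits Q w"
            then have "\<not> exits Q w'"
              using sep foot(3) foot'(3) by fastforce
            then have "sz (nf Q v') < sz (nf Q w')"
              using not_exits_App[of Q u' v'] AA by auto
            then show False
              using sep(1) foot e Q(2) sz_nf[of Q "foot w"] by fastforce
          qed
          moreover have "\<not> exits Q w'"
          proof
            assume e: "exits Q w'"
            then have "sz (nf Q v) < sz (nf Q w)"
              using \<open>\<not> exits Q w\<close> not_exits_App[of Q u v] AA by auto
            then show False
              using sep(2) foot' e Q(2) sz_nf[of Q "foot w'"] by fastforce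
          qed
          ultimately have "dir Q \<or> opp Q"
            using stuckD Q(2) by blast
          moreover have "\<not> opp Q"
            using sep unfolding opp_def by fastforce
          ultimately show ?thesis by blast
        qed
        with dirD have "dir P \<longleftrightarrow> nf P w = nf P w'" if "P \<in> \<P>" for P
          using that by blast
        with prin_dir show ?thesis
          by (rule prin_cong)
      next
        case nodir: False
        show ?thesis
        proof (cases "\<exists>\<sigma> x y s t l l'. gates v = Code \<sigma> x y s t # l \<and> gates v' = Code (\<not> \<sigma>) x y s t # l'")
          case True
          then obtain \<sigma> x y s t l l' where g: "gates v = Code \<sigma> x y s t # l"
            "gates v' = Code (\<not> \<sigma>) x y s t # l'"
            by blast
          let ?c = "Code \<sigma> x y s t" and ?c' = "Code (\<not> \<sigma>) x y s t"
          have cT: "?c \<in> T" "?c' \<in> T"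
            using g gates_tms[OF uv(2)] gates_tms[OF uv(4)] by auto
          then have tT: "t \<in> T" and valid: "\<And>P. P \<in> \<P> \<Longrightarrow> nf P s = nf P t \<longleftrightarrow> nf P x = nf P y"
            by (auto elim: tms_CodeE)
          have szs: "sz ?c \<le> sz v" "sz ?c' \<le> sz v'" "sz t < sz ?c" "sz t < sz ?c'"
            using sz_gate_Cons[OF g(1)] sz_gate_Cons[OF g(2)] by auto
          have opp: "opp P \<longleftrightarrow> nf P v = nf P ?c \<and> nf P v' = nf P ?c' \<and> nf P u = nf P t \<and> nf P u' = nf P t" for P
            using nf_code_gates[of P v] nf_code_gates[of P v'] g unfolding opp_def by auto
          have same: "exits P w \<longleftrightarrow> exits P w'" if "nf P w = nf P w'" for P
            using exits_dominance[of w w' P] exits_dominance[of w' w P] exits_hangs[of P w]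
              exits_hangs[of P w'] that g AA by auto
          have oppI: "nf P w = nf P w'" if P: "P \<in> \<P>" "opp P" for P
          proof -
            have *: "nf P v = ?c" "nf P v' = ?c'" "nf P u = nf P t" "nf P u' = nf P t"
              using P(2) opp by auto
            have "nf P x = nf P y" if "nf P t = nf P s"
              using valid[OF P(1)] that by simp
            then show ?thesis
              using * nf_App_code[OF *(1), of u] nf_App_code[OF *(2), of u'] AA by auto
          qed
          \<comment> \<open>If both exit, then \<open>x\<close> and \<open>y\<close> are identified,
            hence so are \<open>s\<close> and \<open>t\<close> by validity of the code; left factors
            that match \<open>s\<close> therefore match \<open>t\<close>.\<close>
          have oppE: "opp P" if P: "P \<in> \<P>" "nf P w = nf P w'" for P
          proof (cases "exits P w")
            case e: True
            then have *: "nf P v = ?c" "nf P u = nf P s" "nf P v' = ?c'" "nf P u' = nf P s"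
              using same[OF P(2)] exits_App_gate[OF g(1)] exits_App_gate[OF g(2)] AA by auto
            then have "nf P (if \<sigma> then y else x) = nf P (if \<sigma> then x else y)"
              using P(2) AA nf_App_code[OF *(1), of u] nf_App_code[OF *(3), of u'] by simp
            then have "nf P s = nf P t"
              using valid[OF P(1)] by (auto split: if_splits)
            then show ?thesis
              using * by (simp add: opp)
          next
            case False
            then have "dir P \<or> opp P"
              using stuckD same P(2) by blast
            then show ?thesis
              using nodir P(1) by blast
          qed
          have "prin opp"
          proof -
            have "prin (\<lambda>P. nf P v = nf P ?c \<and> nf P v' = nf P ?c' \<and> nf P u = nf P t \<and> nf P u' = nf P t)"
              using uv cT tT szs AA by (intro prin_conj IH) auto
            then show ?thesis
              by (rule prin_cong) (simp only: opp)
          qed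
          then show ?thesis
            by (rule prin_cong) (use oppI oppE in blast)
        next
          case False
          \<comment> \<open>Neither \<open>dir\<close> nor \<open>opp\<close> is possible here, so
            two products that both stay have different normal forms.\<close>
          then have no: "exits P w \<or> exits P w'" if "P \<in> \<P>" "nf P w = nf P w'" for P
            using stuckD[of P] oppD[of P] nodir that by blast
          have "hangs w \<or> hangs w'"
            using gne AA by auto
          then show ?thesis
            using both left right no exits_hangs by blast
        qed
      qed
    qed
  qed
qed

end

section \<open>Groupoids with a semilattice-valued distance\<close>

context join_semilattice0
begin

lemma bottom_carrier [simp]: "\<bottom> \<in> carrier L"
  using bottom_least by (simp add: least_def)

lemma bottom_le [simp]: "x \<in> carrier L \<Longrightarrow> \<bottom> \<sqsubseteq> x"
  using bottom_least by (simp add: least_def)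

lemma le_bottom_iff: "x \<in> carrier L \<Longrightarrow> x \<sqsubseteq> \<bottom> \<longleftrightarrow> x = \<bottom>"
  by (metis bottom_carrier bottom_le le_antisym le_refl)

lemma join_le_iff:
  "\<lbrakk>x \<in> carrier L; y \<in> carrier L; z \<in> carrier L\<rbrakk> \<Longrightarrow> x \<squnion> y \<sqsubseteq> z \<longleftrightarrow> x \<sqsubseteq> z \<and> y \<sqsubseteq> z"
  by (meson join_closed join_le join_left join_right le_trans)

end

lemma hom_join0_mono:
  assumes "join_semilattice0 L" "join_semilattice0 M" "f \<in> hom_join0 L M"
    and "x \<in> carrier L" "y \<in> carrier L" "x \<sqsubseteq>\<^bsub>L\<^esub> y"
  shows "f x \<sqsubseteq>\<^bsub>M\<^esub> f y"
proof -
  interpret L: join_semilattice0 L by fact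
  interpret M: join_semilattice0 M by fact
  have "x \<squnion>\<^bsub>L\<^esub> y = y"
    using assms(4-6) by (meson L.join_closed L.join_le L.join_right L.le_antisym L.le_refl)
  moreover have "f (x \<squnion>\<^bsub>L\<^esub> y) = f x \<squnion>\<^bsub>M\<^esub> f y"
    using assms(3-5) by (simp add: hom_join0_def)
  moreover have "f x \<in> carrier M" "f y \<in> carrier M"
    using assms(3-5) by (auto simp: hom_join0_def)
  ultimately show ?thesis
    using M.join_left[of "f x" "f y"] by simp
qed

text \<open>\<open>G\<close> is the quotient of \<open>F\<close> by the relation of being at distance zero, with projection \<open>p\<close>.\<close>

locale valued_groupoid = join_semilattice0 D for D :: "'a gorder" (structure) +
  fixes F :: "'t set" and m :: "'t \<Rightarrow> 't \<Rightarrow> 't" and \<delta> :: "'t \<Rightarrow> 't \<Rightarrow> 'a"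
    and p :: "'t \<Rightarrow> 'b" and G :: "'b groupoid"
  assumes nonempty: "F \<noteq> {}"
    and mult_closed: "\<lbrakk>s \<in> F; t \<in> F\<rbrakk> \<Longrightarrow> m s t \<in> F"
    and dist_closed: "\<lbrakk>s \<in> F; t \<in> F\<rbrakk> \<Longrightarrow> \<delta> s t \<in> carrier D"
    and dist_self: "s \<in> F \<Longrightarrow> \<delta> s s = \<bottom>"
    and dist_sym: "\<lbrakk>s \<in> F; t \<in> F\<rbrakk> \<Longrightarrow> \<delta> s t = \<delta> t s"
    and dist_triangle: "\<lbrakk>s \<in> F; t \<in> F; u \<in> F\<rbrakk> \<Longrightarrow> \<delta> s u \<sqsubseteq> \<delta> s t \<squnion> \<delta> t u"
    and dist_mult: "\<lbrakk>s \<in> F; t \<in> F; s' \<in> F; t' \<in> F\<rbrakk> \<Longrightarrow> \<delta> (m s t) (m s' t') \<sqsubseteq> \<delta> s s' \<squnion> \<delta> t t'"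
    and dist_surj: "a \<in> carrier D \<Longrightarrow> \<exists>s\<in>F. \<exists>t\<in>F. \<delta> s t = a"
    and dist_forcing: "\<lbrakk>equiv F \<theta>;
        \<And>s s' t t'. (s, s') \<in> \<theta> \<Longrightarrow> (t, t') \<in> \<theta> \<Longrightarrow> (m s t, m s' t') \<in> \<theta>;
        \<And>s t. s \<in> F \<Longrightarrow> t \<in> F \<Longrightarrow> \<delta> s t = \<bottom> \<Longrightarrow> (s, t) \<in> \<theta>;
        (s1, t1) \<in> \<theta>; (s2, t2) \<in> \<theta>; x \<in> F; y \<in> F; \<delta> x y \<sqsubseteq> \<delta> s1 t1 \<squnion> \<delta> s2 t2\<rbrakk> \<Longrightarrow> (x, y) \<in> \<theta>"
    and proj_eq: "\<lbrakk>s \<in> F; t \<in> F\<rbrakk> \<Longrightarrow> p s = p t \<longleftrightarrow> \<delta> s t = \<bottom>"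
    and carrier_G: "carrier G = p ` F"
    and mult_G: "\<lbrakk>s \<in> F; t \<in> F\<rbrakk> \<Longrightarrow> p s \<cdot>\<^bsub>G\<^esub> p t = p (m s t)"
begin

definition ball :: "'a \<Rightarrow> 'b rel" where
  "ball d = {(p s, p t) | s t. s \<in> F \<and> t \<in> F \<and> \<delta> s t \<sqsubseteq> d}"

lemma groupoid_G: "groupoid G"
  by unfold_locales (use nonempty mult_closed in \<open>auto simp: carrier_G mult_G\<close>)

lemma dist_le_trans:
  assumes "s \<in> F" "t \<in> F" "u \<in> F" "d \<in> carrier D" "\<delta> s t \<sqsubseteq> d" "\<delta> t u \<sqsubseteq> d"
  shows "\<delta> s u \<sqsubseteq> d"
  by (rule le_trans[OF dist_triangle[of s t u]]) (use assms dist_closed in \<open>simp_all add: join_le_iff\<close>)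

lemma ball_iff:
  assumes "s \<in> F" "t \<in> F" "d \<in> carrier D"
  shows "(p s, p t) \<in> ball d \<longleftrightarrow> \<delta> s t \<sqsubseteq> d"
proof
  assume "(p s, p t) \<in> ball d"
  then obtain s' t' where *: "p s = p s'" "p t' = p t" "s' \<in> F" "t' \<in> F" "\<delta> s' t' \<sqsubseteq> d"
    unfolding ball_def by force
  then have "\<delta> s s' \<sqsubseteq> d" "\<delta> t' t \<sqsubseteq> d"
    using assms by (simp_all add: proj_eq)
  then show "\<delta> s t \<sqsubseteq> d"
    using * assms dist_le_trans by meson
qed (use assms in \<open>auto simp: ball_def\<close>)

lemma congruence_ball:
  assumes d: "d \<in> carrier D"
  shows "congruence G (ball d)"
  unfolding congruence_def
proof (intro conjI allI impI)
  show "equiv (carrier G) (ball d)"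
  proof (rule equivI)
    show "ball d \<subseteq> carrier G \<times> carrier G"
      by (auto simp: ball_def carrier_G)
    show "refl_on (carrier G) (ball d)"
      using d by (auto simp: refl_on_def carrier_G ball_iff dist_self)
    show "sym (ball d)"
      unfolding sym_def ball_def using dist_sym by fastforce
    show "trans (ball d)"
    proof (rule transI)
      fix x y z assume "(x, y) \<in> ball d" "(y, z) \<in> ball d"
      moreover from this obtain s t u where "x = p s" "y = p t" "z = p u" "s \<in> F" "t \<in> F" "u \<in> F"
        unfolding ball_def by blast
      ultimately show "(x, z) \<in> ball d"
        using d dist_le_trans[of s t u d] by (simp add: ball_iff)
    qed
  qed
  fix x x' y y' assume "(x, x') \<in> ball d" "(y, y') \<in> ball d"
  moreover from this obtain s s' t t' where
    *: "x = p s" "x' = p s'" "y = p t" "y' = p t'" "s \<in> F" "s' \<in> F" "t \<in> F" "t' \<in> F"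
    unfolding ball_def by blast
  ultimately have "\<delta> s s' \<squnion> \<delta> t t' \<sqsubseteq> d"
    using d dist_closed by (simp add: ball_iff join_le_iff)
  with * d dist_mult[of s t s' t'] have "\<delta> (m s t) (m s' t') \<sqsubseteq> d"
    using mult_closed dist_closed by (meson join_closed le_trans)
  then show "(x \<cdot>\<^bsub>G\<^esub> y, x' \<cdot>\<^bsub>G\<^esub> y') \<in> ball d"
    using * d mult_closed by (simp add: mult_G ball_iff)
qed

text \<open>The pullback of \<open>\<Theta>\<close> along the projection is a relation on
  \<open>F\<close> to which \<open>dist_forcing\<close> applies.\<close>

lemma congruence_forcing:
  assumes "congruence G \<Theta>" "(p s1, p t1) \<in> \<Theta>" "(p s2, p t2) \<in> \<Theta>"
    and F: "s1 \<in> F" "t1 \<in> F" "s2 \<in> F" "t2 \<in> F" "x \<in> F" "y \<in> F"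
    and le: "\<delta> x y \<sqsubseteq> \<delta> s1 t1 \<squnion> \<delta> s2 t2"
  shows "(p x, p y) \<in> \<Theta>"
proof -
  have E: "equiv (carrier G) \<Theta>"
    and C: "\<And>x x' y y'. (x, x') \<in> \<Theta> \<Longrightarrow> (y, y') \<in> \<Theta> \<Longrightarrow> (x \<cdot>\<^bsub>G\<^esub> y, x' \<cdot>\<^bsub>G\<^esub> y') \<in> \<Theta>"
    using assms(1) unfolding congruence_def by blast+
  let ?\<theta> = "{(s, t). s \<in> F \<and> t \<in> F \<and> (p s, p t) \<in> \<Theta>}"
  have "(x, y) \<in> ?\<theta>"
  proof (rule dist_forcing[OF _ _ _ _ _ F(5,6) le])
    show "equiv F ?\<theta>"
    proof (rule equivI)
      show "refl_on F ?\<theta>"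
        using E by (auto simp: refl_on_def equiv_def carrier_G)
      show "sym ?\<theta>"
        using E by (auto simp: sym_def equiv_def)
      show "trans ?\<theta>"
        using E by (auto simp: equiv_def intro!: transI elim: transE)
    qed auto
    show "(m s t, m s' t') \<in> ?\<theta>" if "(s, s') \<in> ?\<theta>" "(t, t') \<in> ?\<theta>" for s s' t t'
      using that C[of "p s" "p s'" "p t" "p t'"] mult_closed by (auto simp: mult_G)
    show "(s, t) \<in> ?\<theta>" if "s \<in> F" "t \<in> F" "\<delta> s t = \<bottom>" for s t
      using that E proj_eq[of s t] by (auto simp: equiv_def refl_on_def carrier_G)
  qed (use assms in auto)
  then show ?thesis by simp
qed

lemma ball_subset:
  assumes "congruence G \<Theta>" "(p s1, p t1) \<in> \<Theta>" "(p s2, p t2) \<in> \<Theta>"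
    and F: "s1 \<in> F" "t1 \<in> F" "s2 \<in> F" "t2 \<in> F"
  shows "ball (\<delta> s1 t1 \<squnion> \<delta> s2 t2) \<subseteq> \<Theta>"
  using congruence_forcing[OF assms] by (auto simp: ball_def)

lemma ball_subset1:
  assumes "congruence G \<Theta>" "(p s, p t) \<in> \<Theta>" "s \<in> F" "t \<in> F"
  shows "ball (\<delta> s t) \<subseteq> \<Theta>"
proof -
  have "\<delta> s t \<squnion> \<delta> s t = \<delta> s t"
    using dist_closed[OF assms(3,4)] by (meson join_closed join_le join_left le_antisym le_refl)
  then show ?thesis
    using ball_subset[OF assms(1,2,2,3,4,3,4)] by simp
qed

lemma ball_le_iff:
  assumes "d \<in> carrier D" "e \<in> carrier D"
  shows "ball d \<subseteq> ball e \<longleftrightarrow> d \<sqsubseteq> e"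
proof
  assume *: "ball d \<subseteq> ball e"
  obtain s t where st: "s \<in> F" "t \<in> F" "\<delta> s t = d"
    using dist_surj[OF assms(1)] by blast
  then have "(p s, p t) \<in> ball e"
    using * assms ball_iff by blast
  then show "d \<sqsubseteq> e"
    using st assms ball_iff by blast
next
  assume "d \<sqsubseteq> e"
  then show "ball d \<subseteq> ball e"
    unfolding ball_def using assms dist_closed le_trans[of _ d e] by blast
qed

text \<open>Since every value is a distance, the generators treated so far can be replaced by one
  pair at distance \<open>d\<close>. Adding a generator then amounts to forcing from two pairs, and
  the radius becomes the join.\<close>

lemma Cg_finite:
  assumes "finite X" "X \<subseteq> carrier G \<times> carrier G"
  shows "\<exists>d\<in>carrier D. Cg G X = ball d"
  using assms
proof (induction X rule: finite_induct)
  case empty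
  have "ball \<bottom> \<subseteq> \<Theta>" if "congruence G \<Theta>" for \<Theta>
    using that by (auto simp: ball_def le_bottom_iff[OF dist_closed] proj_eq[symmetric]
      congruence_def equiv_def refl_on_def carrier_G)
  then have "Cg G {} = ball \<bottom>"
    unfolding Cg_def by (intro hull_unique congruence_ball) auto
  then show ?case by blast
next
  case (insert z X)
  then obtain d where d: "d \<in> carrier D" "Cg G X = ball d"
    by auto
  obtain s t where st: "s \<in> F" "t \<in> F" "\<delta> s t = d"
    using dist_surj[OF d(1)] by blast
  from insert.prems obtain x y where z: "z = (p x, p y)" and xy: "x \<in> F" "y \<in> F"
    by (auto simp: carrier_G)
  let ?e = "d \<squnion> \<delta> x y"
  have e: "?e \<in> carrier D" "d \<sqsubseteq> ?e" "\<delta> x y \<sqsubseteq> ?e"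
    using d xy dist_closed join_left join_right by auto
  have "Cg G (insert z X) = ball ?e"
    unfolding Cg_def
  proof (rule hull_unique)
    have "X \<subseteq> ball d"
      using d(2) unfolding Cg_def by (metis hull_subset)
    also have "\<dots> \<subseteq> ball ?e"
      using e d by (simp add: ball_le_iff)
    finally show "insert z X \<subseteq> ball ?e"
      using z xy e by (simp add: ball_iff)
    show "congruence G (ball ?e)"
      using e by (simp add: congruence_ball)
    fix \<Theta> assume \<Theta>: "insert z X \<subseteq> \<Theta>" "congruence G \<Theta>"
    then have "ball d \<subseteq> \<Theta>"
      using d(2) unfolding Cg_def by (metis hull_minimal insert_subset)
    then have "(p s, p t) \<in> \<Theta>"
      using ball_iff[OF st(1,2) d(1)] st d by auto
    then show "ball ?e \<subseteq> \<Theta>"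
      using ball_subset[OF \<Theta>(2) _ _ st(1,2) xy] \<Theta>(1) z st(3) by simp
  qed
  then show ?case
    using e by blast
qed

lemma Cg_pair: "s \<in> F \<Longrightarrow> t \<in> F \<Longrightarrow> Cg G {(p s, p t)} = ball (\<delta> s t)"
  unfolding Cg_def using ball_subset1 dist_closed
  by (intro hull_unique) (auto simp: ball_iff congruence_ball)

section \<open>The isomorphism between compact congruences and values\<close>

lemma carrier_Con_c: "carrier (Con_c G) = ball ` carrier D"
proof -
  have "ball d \<in> carrier (Con_c G)" if d: "d \<in> carrier D" for d
  proof -
    obtain s t where st: "s \<in> F" "t \<in> F" "\<delta> s t = d"
      using dist_surj[OF d] by blast
    then have "ball d = Cg G {(p s, p t)}" "{(p s, p t)} \<subseteq> carrier G \<times> carrier G"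
      by (auto simp: Cg_pair carrier_G)
    then show ?thesis
      unfolding Con_c_def by (auto intro!: exI[of _ "{(p s, p t)}"])
  qed
  moreover have "carrier (Con_c G) \<subseteq> ball ` carrier D"
    using Cg_finite unfolding Con_c_def by fastforce
  ultimately show ?thesis by blast
qed

lemma inj_ball: "inj_on ball (carrier D)"
  using ball_le_iff by (intro inj_onI) (metis le_antisym order_refl)

definition radius :: "'b rel \<Rightarrow> 'a" where
  "radius = the_inv_into (carrier D) ball"

lemma radius_ball [simp]: "d \<in> carrier D \<Longrightarrow> radius (ball d) = d"
  unfolding radius_def by (rule the_inv_into_f_f[OF inj_ball])

lemma Con_c_le [simp]: "le (Con_c G) = (\<subseteq>)"
  by (simp add: Con_c_def)

lemma bottom_Con_c: "\<bottom>\<^bsub>Con_c G\<^esub> = ball \<bottom>"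
  unfolding bottom_def[of "Con_c G"]
proof (rule some_equality)
  show *: "least (Con_c G) (ball \<bottom>) (carrier (Con_c G))"
    by (auto simp: least_def carrier_Con_c ball_le_iff)
  show "x = ball \<bottom>" if "least (Con_c G) x (carrier (Con_c G))" for x
    using that * unfolding least_def by (metis Con_c_le subset_antisym)
qed

lemma join_Con_c:
  assumes "a \<in> carrier D" "b \<in> carrier D"
  shows "ball a \<squnion>\<^bsub>Con_c G\<^esub> ball b = ball (a \<squnion> b)"
  unfolding join_def[of "Con_c G"] sup_def
proof (rule some_equality)
  have U: "Upper (Con_c G) {ball a, ball b} = ball ` {d \<in> carrier D. a \<sqsubseteq> d \<and> b \<sqsubseteq> d}"
    by (rule Set.set_eqI) (use assms in \<open>auto simp: Upper_def carrier_Con_c ball_le_iff del: subsetI\<close>)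
  show *: "least (Con_c G) (ball (a \<squnion> b)) (Upper (Con_c G) {ball a, ball b})"
    unfolding U least_def using assms join_left join_right
    by (intro conjI) (auto simp: carrier_Con_c ball_le_iff join_le_iff del: subsetI intro!: image_mono)
  show "x = ball (a \<squnion> b)" if "least (Con_c G) x (Upper (Con_c G) {ball a, ball b})" for x
    using that * unfolding least_def by (metis Con_c_le subset_antisym)
qed

lemma radius_iso: "radius \<in> iso_join0 (Con_c G) D"
proof -
  have "bij_betw radius (carrier (Con_c G)) (carrier D)"
    unfolding carrier_Con_c radius_def by (rule bij_betw_the_inv_into) (simp add: bij_betw_def inj_ball)
  then show ?thesis
    by (auto simp: iso_join0_def hom_join0_def carrier_Con_c bottom_Con_c join_Con_c)
qed

end

text \<open>The ball of radius \<open>d\<close> contains a pair at distance exactly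
  \<open>d\<close>. Its image lies at distance \<open>\<phi> d\<close> and generates the whole
  target ball.\<close>

lemma Con_c_map_ball:
  assumes "valued_groupoid D F m \<delta> p G" "valued_groupoid D' F' m \<delta>' p' G'"
    and "F \<subseteq> F'" and \<phi>: "\<phi> \<in> hom_join0 D D'"
    and dist: "\<And>s t. s \<in> F \<Longrightarrow> t \<in> F \<Longrightarrow> \<delta>' s t = \<phi> (\<delta> s t)"
    and f: "\<And>s. s \<in> F \<Longrightarrow> f (p s) = p' s"
    and d: "d \<in> carrier D"
  shows "Con_c_map G' f (valued_groupoid.ball D F \<delta> p d) = valued_groupoid.ball D' F' \<delta>' p' (\<phi> d)"
proof -
  interpret A: valued_groupoid D F m \<delta> p G by fact
  interpret B: valued_groupoid D' F' m \<delta>' p' G' by fact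
  have \<phi>d: "\<phi> d \<in> carrier D'"
    using \<phi> d by (auto simp: hom_join0_def)
  show ?thesis
    unfolding Con_c_map_def Cg_def
  proof (rule hull_unique)
    show "{(f x, f y) |x y. (x, y) \<in> A.ball d} \<subseteq> B.ball (\<phi> d)"
    proof clarify
      fix x y assume "(x, y) \<in> A.ball d"
      then obtain s t where st: "x = p s" "y = p t" "s \<in> F" "t \<in> F" "\<delta> s t \<sqsubseteq>\<^bsub>D\<^esub> d"
        unfolding A.ball_def by blast
      have "\<phi> (\<delta> s t) \<sqsubseteq>\<^bsub>D'\<^esub> \<phi> d"
        using hom_join0_mono[OF A.join_semilattice0_axioms B.join_semilattice0_axioms \<phi>] st d A.dist_closed
        by blast
      then show "(f x, f y) \<in> B.ball (\<phi> d)"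
        using st \<open>F \<subseteq> F'\<close> B.ball_iff[OF _ _ \<phi>d, of s t] by (simp add: f dist subset_iff)
    qed
    show "congruence G' (B.ball (\<phi> d))"
      using \<phi>d by (rule B.congruence_ball)
    fix \<Theta> assume \<Theta>: "{(f x, f y) |x y. (x, y) \<in> A.ball d} \<subseteq> \<Theta>" "congruence G' \<Theta>"
    obtain s t where st: "s \<in> F" "t \<in> F" "\<delta> s t = d"
      using A.dist_surj[OF d] by blast
    then have "(p' s, p' t) \<in> \<Theta>"
      using \<Theta>(1) A.ball_iff[OF st(1,2) d] f d by fastforce
    then show "B.ball (\<phi> d) \<subseteq> \<Theta>"
      using B.ball_subset1[OF \<Theta>(2)] st \<open>F \<subseteq> F'\<close> dist by fastforce
  qed
qed

section \<open>The distance defined by proper ideals\<close>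

text \<open>Properness lets \<open>\<top>\<close> represent the condition that never holds, which is
  how distinct codes come to be at distance \<open>\<top>\<close>. It passes to preimages because
  the maps preserve the greatest element.\<close>

definition proper_ideals :: "('a, 'm) gorder_scheme \<Rightarrow> 'a set set" where
  "proper_ideals L = {J. J \<subseteq> carrier L \<and> \<bottom>\<^bsub>L\<^esub> \<in> J \<and> \<top>\<^bsub>L\<^esub> \<notin> J \<and>
     (\<forall>x\<in>J. \<forall>y\<in>carrier L. y \<sqsubseteq>\<^bsub>L\<^esub> x \<longrightarrow> y \<in> J) \<and>
     (\<forall>x\<in>J. \<forall>y\<in>J. x \<squnion>\<^bsub>L\<^esub> y \<in> J)}"

context join_semilattice01
begin

lemma ideal_join_iff:
  "\<lbrakk>J \<in> proper_ideals L; x \<in> carrier L; y \<in> carrier L\<rbrakk> \<Longrightarrow> x \<squnion> y \<in> J \<longleftrightarrow> x \<in> J \<and> y \<in> J"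
  unfolding proper_ideals_def using join_left join_right by blast

lemma ideal_down: "\<lbrakk>J \<in> proper_ideals L; x \<in> J; y \<in> carrier L; y \<sqsubseteq> x\<rbrakk> \<Longrightarrow> y \<in> J"
  unfolding proper_ideals_def by blast

lemma ideal_bottom: "J \<in> proper_ideals L \<Longrightarrow> \<bottom> \<in> J"
  and ideal_top: "J \<in> proper_ideals L \<Longrightarrow> \<top> \<notin> J"
  unfolding proper_ideals_def by blast+

text \<open>The principal ideal below \<open>y\<close> separates, unless it contains
  \<open>\<top>\<close>; in that case every element is below \<open>y\<close>.\<close>

lemma le_iff_ideals:
  assumes "x \<in> carrier L" "y \<in> carrier L"
  shows "x \<sqsubseteq> y \<longleftrightarrow> (\<forall>J\<in>proper_ideals L. y \<in> J \<longrightarrow> x \<in> J)"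
proof
  assume *: "\<forall>J\<in>proper_ideals L. y \<in> J \<longrightarrow> x \<in> J"
  show "x \<sqsubseteq> y"
  proof (cases "\<top> \<sqsubseteq> y")
    case True
    show ?thesis
      by (rule le_trans[OF top_higher True]) (use assms in simp_all)
  next
    case False
    have "{z \<in> carrier L. z \<sqsubseteq> y} \<in> proper_ideals L"
      unfolding proper_ideals_def mem_Collect_eq
    proof (intro conjI ballI impI)
      show "w \<sqsubseteq> y" if "z \<in> {z \<in> carrier L. z \<sqsubseteq> y}" "w \<in> carrier L" "w \<sqsubseteq> z" for z w
        using that assms le_trans[of w z y] by simp
    qed (use assms False in \<open>auto simp: join_le_iff\<close>)
    with * assms show ?thesis
      by auto
  qed
qed (use assms ideal_down in blast)

end

text \<open>Labels are kept apart from their values so that one term can be read in several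
  semilattices of the diagram.\<close>

locale labelled = join_semilattice01 D for D :: "'a gorder" (structure) +
  fixes \<Lambda> :: "'l set" and val :: "'l \<Rightarrow> 'a"
  assumes val_closed: "b \<in> \<Lambda> \<Longrightarrow> val b \<in> carrier D"
    and val_surj: "a \<in> carrier D \<Longrightarrow> \<exists>b\<in>\<Lambda>. val b = a"
begin

abbreviation nfi :: "'a set \<Rightarrow> 'l tm \<Rightarrow> 'l tm" where
  "nfi J \<equiv> nf (\<lambda>b. val b \<in> J)"

definition \<P> :: "('l \<Rightarrow> bool) set" where
  "\<P> = (\<lambda>J b. val b \<in> J) ` proper_ideals D"

definition prin :: "(('l \<Rightarrow> bool) \<Rightarrow> bool) \<Rightarrow> bool" where
  "prin H \<longleftrightarrow> (\<exists>d\<in>carrier D. \<forall>J\<in>proper_ideals D. H (\<lambda>b. val b \<in> J) \<longleftrightarrow> d \<in> J)"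

sublocale principal \<Lambda> \<P> prin
proof
  fix F G :: "('l \<Rightarrow> bool) \<Rightarrow> bool"
  show "prin F \<Longrightarrow> (\<And>P. P \<in> \<P> \<Longrightarrow> F P = G P) \<Longrightarrow> prin G"
    by (auto simp: prin_def \<P>_def)
  show "prin (\<lambda>_. True)"
    unfolding prin_def using ideal_bottom by (intro bexI[of _ \<bottom>]) auto
  show "prin (\<lambda>_. False)"
    unfolding prin_def using ideal_top by (intro bexI[of _ \<top>]) auto
  show "prin (\<lambda>P. F P \<and> G P)" if FG: "prin F" "prin G"
  proof -
    obtain d e where "d \<in> carrier D" "\<forall>J\<in>proper_ideals D. F (\<lambda>b. val b \<in> J) \<longleftrightarrow> d \<in> J"
      "e \<in> carrier D" "\<forall>J\<in>proper_ideals D. G (\<lambda>b. val b \<in> J) \<longleftrightarrow> e \<in> J"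
      using FG unfolding prin_def by blast
    then show ?thesis
      unfolding prin_def by (intro bexI[of _ "d \<squnion> e"]) (auto simp: ideal_join_iff)
  qed
  show "prin (\<lambda>P. P b)" if "b \<in> \<Lambda>" for b
    unfolding prin_def using val_closed[OF that] by auto
qed

definition dist :: "'l tm \<Rightarrow> 'l tm \<Rightarrow> 'a" where
  "dist s t = (SOME d. d \<in> carrier D \<and> (\<forall>J\<in>proper_ideals D. nfi J s = nfi J t \<longleftrightarrow> d \<in> J))"

lemma dist:
  assumes "s \<in> T" "t \<in> T"
  shows dist_carrier: "dist s t \<in> carrier D"
    and nfi_eq_iff: "J \<in> proper_ideals D \<Longrightarrow> nfi J s = nfi J t \<longleftrightarrow> dist s t \<in> J"
proof -
  have "\<exists>d. d \<in> carrier D \<and> (\<forall>J\<in>proper_ideals D. nfi J s = nfi J t \<longleftrightarrow> d \<in> J)"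
    using prin_eqv[OF assms] unfolding prin_def by blast
  from someI_ex[OF this]
  show "dist s t \<in> carrier D" "J \<in> proper_ideals D \<Longrightarrow> nfi J s = nfi J t \<longleftrightarrow> dist s t \<in> J"
    unfolding dist_def by blast+
qed

lemma dist_le_iff:
  assumes "s \<in> T" "t \<in> T" "d \<in> carrier D"
  shows "dist s t \<sqsubseteq> d \<longleftrightarrow> (\<forall>J\<in>proper_ideals D. d \<in> J \<longrightarrow> nfi J s = nfi J t)"
  using le_iff_ideals[OF dist_carrier[OF assms(1,2)] assms(3)] nfi_eq_iff[OF assms(1,2)] by auto

lemma dist_eqI:
  assumes "s \<in> T" "t \<in> T" "d \<in> carrier D" "\<And>J. J \<in> proper_ideals D \<Longrightarrow> nfi J s = nfi J t \<longleftrightarrow> d \<in> J"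
  shows "dist s t = d"
  using assms le_iff_ideals[of "dist s t" d] le_iff_ideals[of d "dist s t"] nfi_eq_iff[OF assms(1,2)]
    dist_carrier[OF assms(1,2)] by (intro le_antisym) auto

lemma dist_eq_bottom_iff:
  assumes "s \<in> T" "t \<in> T"
  shows "dist s t = \<bottom> \<longleftrightarrow> (\<forall>J\<in>proper_ideals D. nfi J s = nfi J t)"
  using dist_le_iff[OF assms bottom_carrier] le_bottom_iff[OF dist_carrier[OF assms]] ideal_bottom by auto

lemma Cell_T:
  assumes "b \<in> \<Lambda>" "c \<in> \<Lambda>" "x \<in> T" "y \<in> T" "dist x y \<sqsubseteq> val b \<squnion> val c"
  shows "Cell m b c x y \<in> T"
proof (rule tms.Cell)
  fix P assume "P \<in> \<P>" "P b" "P c"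
  then obtain J where J: "J \<in> proper_ideals D" "P = (\<lambda>b. val b \<in> J)" "val b \<squnion> val c \<in> J"
    unfolding \<P>_def using assms val_closed ideal_join_iff by blast
  then show "nf P x = nf P y"
    using assms val_closed dist_le_iff[of x y "val b \<squnion> val c"] by simp
qed (use assms in auto)

lemma Code_T:
  assumes "x \<in> T" "y \<in> T" "s \<in> T" "t \<in> T" "gates x = gates y" "dist x y = dist s t"
  shows "Code \<sigma> x y s t \<in> T"
  using assms nfi_eq_iff by (intro tms.Code) (auto simp: \<P>_def)

text \<open>A pair of codes carries \<open>(s, t)\<close> to any pair with equal gates and the same
  distance; a path of cells with labels \<open>b, c, b, c\<close> then splits \<open>(x, y)\<close>
  into steps of this kind.\<close>

lemma forcing:
  assumes E: "equiv T \<theta>"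
    and C: "\<And>s s' t t'. (s, s') \<in> \<theta> \<Longrightarrow> (t, t') \<in> \<theta> \<Longrightarrow> (App s t, App s' t') \<in> \<theta>"
    and Z: "\<And>s t. s \<in> T \<Longrightarrow> t \<in> T \<Longrightarrow> dist s t = \<bottom> \<Longrightarrow> (s, t) \<in> \<theta>"
    and \<theta>: "(s1, t1) \<in> \<theta>" "(s2, t2) \<in> \<theta>"
    and xy: "x \<in> T" "y \<in> T" and le: "dist x y \<sqsubseteq> dist s1 t1 \<squnion> dist s2 t2"
  shows "(x, y) \<in> \<theta>"
proof -
  have field: "s \<in> T" "t \<in> T" if "(s, t) \<in> \<theta>" for s t
    using E that by (auto simp: equiv_def)
  have refl: "(s, s) \<in> \<theta>" if "s \<in> T" for s
    using E that by (auto simp: equiv_def refl_on_def)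
  have sym: "(t, s) \<in> \<theta>" if "(s, t) \<in> \<theta>" for s t
    using E that by (auto simp: equiv_def sym_def)
  have trans: "(s, u) \<in> \<theta>" if "(s, t) \<in> \<theta>" "(t, u) \<in> \<theta>" for s t u
    using E that by (auto simp: equiv_def elim: transE)
  have zero: "(s, t) \<in> \<theta>" if "s \<in> T" "t \<in> T" "\<And>J. J \<in> proper_ideals D \<Longrightarrow> nfi J s = nfi J t" for s t
    using that Z dist_eq_bottom_iff by blast
  have transport: "(v, w) \<in> \<theta>"
    if st: "(s, t) \<in> \<theta>" and vw: "v \<in> T" "w \<in> T" "gates v = gates w" "dist v w = dist s t" for s t v w
  proof -
    have stT: "s \<in> T" "t \<in> T"
      using field st by auto
    let ?C = "\<lambda>\<sigma>. Code \<sigma> v w s t"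
    have CT: "?C \<sigma> \<in> T" for \<sigma>
      using Code_T vw stT by simp
    have AT: "App z (?C \<sigma>) \<in> T" if "z \<in> T" for z \<sigma>
      using that CT by (rule tms.App)
    \<comment> \<open>The chain runs from \<open>v\<close> through s L, t L, t R and s R to
      \<open>w\<close>: its steps are alternately at distance zero and products of
      \<open>(s, t)\<close> with a code.\<close>
    have "(v, App s (?C False)) \<in> \<theta>" "(App s (?C True), w) \<in> \<theta>"
      using vw(1,2) stT by (auto intro!: zero AT simp: nf_App)
    \<comment> \<open>If \<open>s\<close> and \<open>t\<close> are identified for \<open>J\<close>,
      these products collapse to \<open>v\<close> and \<open>w\<close>, which are then identified
      because the distances agree.\<close>
    moreover have "nfi J (App t (?C False)) = nfi J (App t (?C True))" if J: "J \<in> proper_ideals D" for J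
      using nfi_eq_iff[OF vw(1,2) J] nfi_eq_iff[OF stT J] vw(4) by (auto simp: nf_App)
    then have "(App t (?C False), App t (?C True)) \<in> \<theta>"
      using zero[OF AT AT] stT by blast
    moreover have "(App s (?C \<sigma>), App t (?C \<sigma>)) \<in> \<theta>" for \<sigma>
      using C[OF st refl[OF CT]] .
    ultimately show ?thesis
      using trans sym by meson
  qed
  obtain b c where b: "b \<in> \<Lambda>" "val b = dist s1 t1" and c: "c \<in> \<Lambda>" "val c = dist s2 t2"
    using val_surj dist_carrier field \<theta> by metis
  let ?Z = "\<lambda>m. Cell m b c x y"
  have ZT: "?Z m \<in> T" for m
    using Cell_T b c xy le by simp
  have both: "nfi J x = nfi J y" if "J \<in> proper_ideals D" "val b \<in> J" "val c \<in> J" for J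
    using ZT that by (auto simp: \<P>_def elim!: tms_CellE)
  have ne: "nfi J x \<noteq> ?Z m" "nfi J y \<noteq> ?Z m" for J m
    using sz_nf[of "\<lambda>b. val b \<in> J" x] sz_nf[of "\<lambda>b. val b \<in> J" y] by auto
  note simps = settle_def ne ne[symmetric]
  have d1: "dist x (?Z P1) = dist s1 t1" and d2: "dist (?Z P4) (?Z P3) = dist s1 t1"
    using b ZT xy val_closed[OF b(1)] both by (intro dist_eqI; auto simp: simps)+
  have d3: "dist (?Z P1) (?Z P2) = dist s2 t2" and d4: "dist (?Z P3) y = dist s2 t2"
    using c ZT xy val_closed[OF c(1)] both by (intro dist_eqI; auto simp: simps)+
  have "(x, ?Z P1) \<in> \<theta>"
    by (rule transport[OF \<theta>(1)]) (use xy ZT d1 in auto)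
  moreover have "(?Z P1, ?Z P2) \<in> \<theta>"
    by (rule transport[OF \<theta>(2)]) (use xy ZT d3 in auto)
  \<comment> \<open>At distance zero, this step passes from the gates of \<open>x\<close> to those
    of \<open>y\<close>; all other steps keep the gates, as \<open>transport\<close>
    demands.\<close>
  moreover have "(?Z P2, ?Z P4) \<in> \<theta>"
    by (rule zero) (use ZT both in \<open>auto simp: simps\<close>)
  moreover have "(?Z P4, ?Z P3) \<in> \<theta>"
    by (rule transport[OF \<theta>(1)]) (use xy ZT d2 in auto)
  moreover have "(?Z P3, y) \<in> \<theta>"
    by (rule transport[OF \<theta>(2)]) (use xy ZT d4 in auto)
  ultimately show ?thesis
    using trans by meson
qed

text \<open>Choosing a representative of the class of \<open>s\<close> keeps the quotient within the type of terms.\<close>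

definition proj :: "('l tm \<Rightarrow> 'b) \<Rightarrow> 'l tm \<Rightarrow> 'b" where
  "proj enc s = (let K = \<lambda>s. restrict (\<lambda>J. nfi J s) (proper_ideals D) in enc (inv_into T K (K s)))"

definition quotient :: "('l tm \<Rightarrow> 'b) \<Rightarrow> 'b groupoid" where
  "quotient enc = \<lparr>carrier = proj enc ` T,
     gmult = \<lambda>x y. proj enc (App (inv_into T (proj enc) x) (inv_into T (proj enc) y))\<rparr>"

lemma proj_eq_iff:
  assumes "inj enc" "s \<in> T" "t \<in> T"
  shows "proj enc s = proj enc t \<longleftrightarrow> dist s t = \<bottom>"
proof -
  let ?K = "\<lambda>s. restrict (\<lambda>J. nfi J s) (proper_ideals D)"
  have "proj enc s = proj enc t \<longleftrightarrow> inv_into T ?K (?K s) = inv_into T ?K (?K t)"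
    using assms(1) by (simp add: proj_def inj_eq)
  also have "\<dots> \<longleftrightarrow> ?K s = ?K t"
    using assms(2,3) by (metis (no_types, lifting) f_inv_into_f imageI)
  also have "\<dots> \<longleftrightarrow> (\<forall>J\<in>proper_ideals D. nfi J s = nfi J t)"
    by (auto simp: fun_eq_iff restrict_def)
  finally show ?thesis
    using assms(2,3) by (simp add: dist_eq_bottom_iff)
qed

lemma valued_groupoid_quotient:
  assumes "inj enc"
  shows "valued_groupoid D T App dist (proj enc) (quotient enc)"
proof unfold_locales
  show "T \<noteq> {}"
    using tms.Org by blast
  show "App s t \<in> T" if "s \<in> T" "t \<in> T" for s t
    using that by (rule tms.App)
  show "dist s t \<in> carrier D" if "s \<in> T" "t \<in> T" for s t
    using that by (rule dist_carrier)
  show "dist s s = \<bottom>" if "s \<in> T" for s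
    using that by (simp add: dist_eq_bottom_iff)
  show "dist s t = dist t s" for s t
    unfolding dist_def by (simp add: eq_commute)
  show "dist s u \<sqsubseteq> dist s t \<squnion> dist t u" if "s \<in> T" "t \<in> T" "u \<in> T" for s t u
    using that dist_carrier by (simp add: dist_le_iff ideal_join_iff nfi_eq_iff[symmetric])
  show "dist (App s t) (App s' t') \<sqsubseteq> dist s s' \<squnion> dist t t'"
    if "s \<in> T" "t \<in> T" "s' \<in> T" "t' \<in> T" for s t s' t'
    using that dist_carrier
    by (auto simp: dist_le_iff tms.App ideal_join_iff nfi_eq_iff[symmetric] intro!: nf_App_cong)
  show "\<exists>s\<in>T. \<exists>t\<in>T. dist s t = a" if a: "a \<in> carrier D" for a
  proof -
    obtain b where b: "b \<in> \<Lambda>" "val b = a"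
      using val_surj[OF a] by blast
    \<comment> \<open>This tip collapses to \<open>Org\<close> exactly if \<open>b\<close> is
      collapsed, so its distance from \<open>Org\<close> is the value of \<open>b\<close>.\<close>
    have "Cell P1 b b Org Org \<in> T"
      using b(1) tms.Org by (intro tms.Cell) auto
    moreover from this have "dist Org (Cell P1 b b Org Org) = a"
      using a b tms.Org by (intro dist_eqI) auto
    ultimately show ?thesis
      using tms.Org by blast
  qed
  show "(x, y) \<in> \<theta>"
    if "equiv T \<theta>"
      "\<And>s s' t t'. (s, s') \<in> \<theta> \<Longrightarrow> (t, t') \<in> \<theta> \<Longrightarrow> (App s t, App s' t') \<in> \<theta>"
      "\<And>s t. s \<in> T \<Longrightarrow> t \<in> T \<Longrightarrow> dist s t = \<bottom> \<Longrightarrow> (s, t) \<in> \<theta>"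
      "(s1, t1) \<in> \<theta>" "(s2, t2) \<in> \<theta>" "x \<in> T" "y \<in> T" "dist x y \<sqsubseteq> dist s1 t1 \<squnion> dist s2 t2"
    for \<theta> s1 t1 s2 t2 x y
    using that by (rule forcing)
  show "proj enc s = proj enc t \<longleftrightarrow> dist s t = \<bottom>" if "s \<in> T" "t \<in> T" for s t
    using assms that by (rule proj_eq_iff)
  show "carrier (quotient enc) = proj enc ` T"
    by (simp add: quotient_def)
  show "proj enc s \<cdot>\<^bsub>quotient enc\<^esub> proj enc t = proj enc (App s t)" if st: "s \<in> T" "t \<in> T" for s t
  proof -
    let ?r = "\<lambda>s. inv_into T (proj enc) (proj enc s)"
    have r: "?r z \<in> T" "proj enc (?r z) = proj enc z" if "z \<in> T" for z
      using that by (auto intro: inv_into_into f_inv_into_f)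
    have eq: "nfi J (?r z) = nfi J z" if "z \<in> T" "J \<in> proper_ideals D" for z J
      using that r[OF that(1)] proj_eq_iff[OF assms, of "?r z" z] dist_eq_bottom_iff[of "?r z" z] by blast
    have AT: "App (?r s) (?r t) \<in> T" "App s t \<in> T"
      using st r by (auto intro: tms.App)
    have "dist (App (?r s) (?r t)) (App s t) = \<bottom>"
      unfolding dist_eq_bottom_iff[OF AT] using eq st by (blast intro: nf_App_cong)
    then show ?thesis
      by (simp add: quotient_def proj_eq_iff[OF assms AT])
  qed
qed

end

section \<open>Terms as lists\<close>

primrec tip_index :: "tip \<Rightarrow> nat" where
  "tip_index P1 = 0" | "tip_index P2 = 1" | "tip_index P3 = 2" | "tip_index P4 = 3"

lemma tip_index_eq_iff [simp]: "tip_index m = tip_index m' \<longleftrightarrow> m = m'"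
  by (cases m; cases m') simp_all

text \<open>Here \<open>h\<close> serves as a pairing function on lists and a number is represented
  by the length of a constant list, which works for every element type.\<close>

primrec encode :: "('a list \<times> 'a list \<Rightarrow> 'a list) \<Rightarrow> ('l \<Rightarrow> 'a list) \<Rightarrow> 'l tm \<Rightarrow> 'a list" where
  "encode h k Org = h (replicate 0 undefined, [])"
| "encode h k (Cell m b c x y) = h (replicate 1 undefined, h (replicate (tip_index m) undefined,
     h (h (k b, k c), h (encode h k x, encode h k y))))"
| "encode h k (Code \<sigma> x y s t) = h (replicate 2 undefined, h (replicate (of_bool \<sigma>) undefined,
     h (h (encode h k x, encode h k y), h (encode h k s, encode h k t))))"
| "encode h k (App u v) = h (replicate 3 undefined, h (encode h k u, encode h k v))"

lemma encode_inject:
  assumes "inj h" "inj k"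
  shows "encode h k v = encode h k w \<Longrightarrow> v = w"
proof (induction v arbitrary: w)
  case Org
  then show ?case
    by (cases w) (auto simp: inj_eq[OF assms(1)] replicate_eq_replicate simp del: replicate.simps)
next
  case (Cell m b c x y)
  then show ?case
    by (cases w) (auto simp: inj_eq[OF assms(1)] inj_eq[OF assms(2)] replicate_eq_replicate
      simp del: replicate.simps)
next
  case (Code \<sigma> x y s t)
  then show ?case
    by (cases w) (auto simp: inj_eq[OF assms(1)] replicate_eq_replicate of_bool_def
      split: if_splits simp del: replicate.simps)
next
  case (App u v)
  then show ?case
    by (cases w) (auto simp: inj_eq[OF assms(1)] replicate_eq_replicate simp del: replicate.simps)
qed

text \<open>A list type is infinite, hence equipotent with its square, which supplies the
  pairing.\<close>

lemma ex_inj_tm_list: "\<exists>enc :: (nat \<times> 'a) tm \<Rightarrow> 'a list. inj enc"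
proof -
  have "\<exists>h. bij_betw h ((UNIV :: 'a list set) \<times> (UNIV :: 'a list set)) (UNIV :: 'a list set)"
    unfolding card_of_ordIso by (rule card_of_Times_same_infinite) (rule infinite_UNIV_listI)
  then obtain h :: "'a list \<times> 'a list \<Rightarrow> 'a list" where h: "inj h"
    by (auto simp: bij_betw_def)
  have "inj (\<lambda>(n, a). h (replicate n undefined, [a :: 'a]))"
    by (auto simp: inj_def inj_eq[OF h] replicate_eq_replicate)
  then show ?thesis
    using encode_inject[OF h] injI by metis
qed

section \<open>Lifting the diagram\<close>

theorem corollary7p10:
  fixes I :: "'i set" and r :: "'i rel"
    and D :: "'i \<Rightarrow> 'a gorder" and \<phi> :: "'i \<Rightarrow> 'i \<Rightarrow> 'a \<Rightarrow> 'a"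
  assumes "finite I" and "partial_order_on I r"
    and "semilattice01_diagram I r D \<phi>"
  shows "\<exists>(A :: 'i \<Rightarrow> 'a list groupoid) f. groupoid_lifting I r D \<phi> A f"
proof -
  interpret poset_diagram I r join_semilattice01 hom_join01 D \<phi>
    using assms(3) by (simp add: semilattice01_diagram_def)
  have r: "r \<subseteq> I \<times> I" "\<And>i. i \<in> I \<Longrightarrow> (i, i) \<in> r"
    "\<And>i j k. (i, j) \<in> r \<Longrightarrow> (j, k) \<in> r \<Longrightarrow> (i, k) \<in> r"
    using assms(2) by (auto simp: partial_order_on_def preorder_on_def refl_on_def elim: transE)
  have \<phi>: "\<phi> i j \<in> hom_join0 (D i) (D j)" "\<phi> i j \<top>\<^bsub>D i\<^esub> = \<top>\<^bsub>D j\<^esub>" if "(i, j) \<in> r" for i j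
    using hom[OF that] by (auto simp: hom_join01_def)
  have \<phi>_closed: "\<phi> i j x \<in> carrier (D j)" if "(i, j) \<in> r" "x \<in> carrier (D i)" for i j x
    using \<phi>(1)[OF that(1)] that(2) by (auto simp: hom_join0_def)
  \<comment> \<open>Numbering the finite poset places all labels in the type
    \<open>nat \<times> 'a\<close>.\<close>
  obtain g :: "'i \<Rightarrow> nat" where g: "inj_on g I"
    using finite_imp_inj_to_nat_seg[OF assms(1)] by blast
  obtain enc :: "(nat \<times> 'a) tm \<Rightarrow> 'a list" where enc: "inj enc"
    using ex_inj_tm_list by blast
  \<comment> \<open>The labels at \<open>j\<close> form the disjoint union of the carriers at all i
    below \<open>j\<close>, read in \<open>D j\<close> through \<open>\<phi>\<close>. So label sets
    increase with \<open>j\<close> and their values are compatible with the maps.\<close>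
  define \<Lambda> where "\<Lambda> j = {(g i, a) | i a. (i, j) \<in> r \<and> a \<in> carrier (D i)}" for j
  define val where "val j = (\<lambda>(n, a). \<phi> (inv_into I g n) j a)" for j
  have val: "val j (g i, a) = \<phi> i j a" if "i \<in> I" for i j a
    using that g by (simp add: val_def)
  have lab: "labelled (D j) (\<Lambda> j) (val j)" if "j \<in> I" for j
  proof -
    interpret join_semilattice01 "D j"
      using obj[OF that] .
    show ?thesis
    proof
      show "val j b \<in> carrier (D j)" if "b \<in> \<Lambda> j" for b
        using that r(1) val \<phi>_closed by (auto simp: \<Lambda>_def)
      show "\<exists>b\<in>\<Lambda> j. val j b = a" if "a \<in> carrier (D j)" for a
        using that \<open>j \<in> I\<close> r(2) val ident by (intro bexI[of _ "(g j, a)"]) (auto simp: \<Lambda>_def)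
    qed
  qed
  define F where "F j = tms (\<Lambda> j) (labelled.\<P> (D j) (val j))" for j
  define \<delta> where "\<delta> j = labelled.dist (D j) (val j)" for j
  define p where "p j = labelled.proj (D j) (\<Lambda> j) (val j) enc" for j
  define A where "A j = labelled.quotient (D j) (\<Lambda> j) (val j) enc" for j
  have vg: "valued_groupoid (D j) (F j) App (\<delta> j) (p j) (A j)" if "j \<in> I" for j
    unfolding F_def \<delta>_def p_def A_def
    using labelled.valued_groupoid_quotient[OF lab[OF that] enc] .
  have nat: "F i \<subseteq> F j \<and> (\<forall>s\<in>F i. \<forall>t\<in>F i. \<delta> j s t = \<phi> i j (\<delta> i s t))" if ij: "(i, j) \<in> r" for i j
  proof -
    have I: "i \<in> I" "j \<in> I"
      using ij r(1) by auto
    interpret i: labelled "D i" "\<Lambda> i" "val i"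
      using lab[OF I(1)] .
    interpret j: labelled "D j" "\<Lambda> j" "val j"
      using lab[OF I(2)] .
    have \<Lambda>: "\<Lambda> i \<subseteq> \<Lambda> j"
      unfolding \<Lambda>_def using ij r(3) by blast
    have val_ij: "val j b = \<phi> i j (val i b)" if b: "b \<in> \<Lambda> i" for b
    proof -
      obtain k a where "b = (g k, a)" "(k, i) \<in> r" "a \<in> carrier (D k)"
        using b by (auto simp: \<Lambda>_def)
      then show ?thesis
        using r(1) val comp[OF _ ij] by auto
    qed
    \<comment> \<open>A proper ideal of \<open>D j\<close> acts on labels of \<open>i\<close> as its
      preimage in \<open>D i\<close> does. Hence normal forms on \<open>F i\<close> agree, and the
      distance is natural.\<close>
    define pre where "pre J = {x \<in> carrier (D i). \<phi> i j x \<in> J}" for J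
    have pre: "pre J \<in> proper_ideals (D i)" if J: "J \<in> proper_ideals (D j)" for J
      unfolding proper_ideals_def mem_Collect_eq
    proof (intro conjI ballI impI)
      show "\<bottom>\<^bsub>D i\<^esub> \<in> pre J"
        using J \<phi>[OF ij] by (auto simp: pre_def hom_join0_def j.ideal_bottom)
      show "\<top>\<^bsub>D i\<^esub> \<notin> pre J"
        using J \<phi>[OF ij] by (auto simp: pre_def j.ideal_top)
      show "y \<in> pre J" if "x \<in> pre J" "y \<in> carrier (D i)" "y \<sqsubseteq>\<^bsub>D i\<^esub> x" for x y
      proof -
        have "\<phi> i j y \<sqsubseteq>\<^bsub>D j\<^esub> \<phi> i j x"
          using that hom_join0_mono[OF i.join_semilattice0_axioms j.join_semilattice0_axioms \<phi>(1)[OF ij]]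
          by (auto simp: pre_def)
        then show ?thesis
          using that j.ideal_down[OF J] \<phi>_closed[OF ij] by (auto simp: pre_def)
      qed
      show "x \<squnion>\<^bsub>D i\<^esub> y \<in> pre J" if "x \<in> pre J" "y \<in> pre J" for x y
      proof -
        have "\<phi> i j (x \<squnion>\<^bsub>D i\<^esub> y) = \<phi> i j x \<squnion>\<^bsub>D j\<^esub> \<phi> i j y"
          using \<phi>(1)[OF ij] that by (simp add: hom_join0_def pre_def)
        then show ?thesis
          using that j.ideal_join_iff[OF J] \<phi>_closed[OF ij] by (auto simp: pre_def)
      qed
    qed (auto simp: pre_def)
    have agree: "val j b \<in> J \<longleftrightarrow> val i b \<in> pre J" if "b \<in> \<Lambda> i" for b J
      using val_ij[OF that] i.val_closed[OF that] by (simp add: pre_def)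
    have sub: "F i \<subseteq> F j"
      unfolding F_def
    proof (rule tms_mono[OF \<Lambda>])
      show "\<exists>Q\<in>i.\<P>. \<forall>b\<in>\<Lambda> i. P b = Q b" if P: "P \<in> j.\<P>" for P
      proof -
        obtain J where "J \<in> proper_ideals (D j)" "P = (\<lambda>b. val j b \<in> J)"
          using P by (auto simp: j.\<P>_def)
        then show ?thesis
          using pre agree by (intro bexI[of _ "\<lambda>b. val i b \<in> pre J"]) (auto simp: i.\<P>_def)
      qed
    qed
    have "\<delta> j s t = \<phi> i j (\<delta> i s t)" if st: "s \<in> F i" "t \<in> F i" for s t
      unfolding \<delta>_def
    proof (rule j.dist_eqI)
      have d: "i.dist s t \<in> carrier (D i)"
        using st i.dist_carrier by (simp add: F_def)
      then show "\<phi> i j (i.dist s t) \<in> carrier (D j)"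
        by (rule \<phi>_closed[OF ij])
      show "j.nfi J s = j.nfi J t \<longleftrightarrow> \<phi> i j (i.dist s t) \<in> J" if J: "J \<in> proper_ideals (D j)" for J
      proof -
        have "j.nfi J z = i.nfi (pre J) z" if "z \<in> F i" for z
          using that agree unfolding F_def by (rule nf_cong)
        then have "j.nfi J s = j.nfi J t \<longleftrightarrow> i.dist s t \<in> pre J"
          using st i.nfi_eq_iff[OF _ _ pre[OF J]] by (simp add: F_def)
        then show ?thesis
          using d by (simp add: pre_def)
      qed
    qed (use st sub in \<open>auto simp: F_def\<close>)
    with sub show ?thesis by blast
  qed
  \<comment> \<open>The chosen representative is immaterial: distance zero in \<open>F i\<close> is
    mapped by \<open>\<phi> i j\<close> to distance zero in \<open>F j\<close>.\<close>
  define f where "f i j x = p j (inv_into (F i) (p i) x)" for i j x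
  have f: "f i j (p i s) = p j s" if ij: "(i, j) \<in> r" and s: "s \<in> F i" for i j s
  proof -
    interpret i: valued_groupoid "D i" "F i" App "\<delta> i" "p i" "A i"
      using vg ij r(1) by blast
    interpret j: valued_groupoid "D j" "F j" App "\<delta> j" "p j" "A j"
      using vg ij r(1) by blast
    let ?t = "inv_into (F i) (p i) (p i s)"
    have t: "?t \<in> F i" "p i ?t = p i s"
      using s by (auto intro: inv_into_into f_inv_into_f)
    then have "\<delta> i ?t s = \<bottom>\<^bsub>D i\<^esub>"
      using s i.proj_eq by blast
    then have "\<delta> j ?t s = \<bottom>\<^bsub>D j\<^esub>"
      using nat[OF ij] t s \<phi>(1)[OF ij] by (auto simp: hom_join0_def)
    then show ?thesis
      unfolding f_def using nat[OF ij] t s j.proj_eq by blast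
  qed
  have "groupoid_diagram I r A f"
    unfolding groupoid_diagram_def
  proof (rule poset_diagram.intro)
    show "groupoid (A i)" if "i \<in> I" for i
      using valued_groupoid.groupoid_G[OF vg[OF that]] .
    show "f i j \<in> hom_groupoid (A i) (A j)" if ij: "(i, j) \<in> r" for i j
    proof -
      interpret i: valued_groupoid "D i" "F i" App "\<delta> i" "p i" "A i"
        using vg ij r(1) by blast
      interpret j: valued_groupoid "D j" "F j" App "\<delta> j" "p j" "A j"
        using vg ij r(1) by blast
      have sub: "s \<in> F j" if "s \<in> F i" for s
        using nat[OF ij] that by blast
      then show ?thesis
        by (auto simp: hom_groupoid_def i.carrier_G j.carrier_G f[OF ij] i.mult_G j.mult_G i.mult_closed)
    qed
    show "f i i x = x" if "i \<in> I" "x \<in> carrier (A i)" for i x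
      using that f[OF r(2)] by (auto simp: valued_groupoid.carrier_G[OF vg])
    show "f j k (f i j x) = f i k x" if ij: "(i, j) \<in> r" and jk: "(j, k) \<in> r" and x: "x \<in> carrier (A i)"
      for i j k x
    proof -
      have "i \<in> I"
        using ij r(1) by blast
      then obtain s where s: "x = p i s" "s \<in> F i"
        using x valued_groupoid.carrier_G[OF vg] by blast
      moreover from this have "s \<in> F j"
        using nat[OF ij] by blast
      ultimately show ?thesis
        using ij jk r(3) by (simp add: f)
    qed
  qed
  moreover have "valued_groupoid.radius (D i) (F i) (\<delta> i) (p i) \<in> iso_join0 (Con_c (A i)) (D i)"
    if "i \<in> I" for i
    using valued_groupoid.radius_iso[OF vg[OF that]] .
  moreover have "valued_groupoid.radius (D j) (F j) (\<delta> j) (p j) (Con_c_map (A j) (f i j) \<alpha>) =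
      \<phi> i j (valued_groupoid.radius (D i) (F i) (\<delta> i) (p i) \<alpha>)"
    if ij: "(i, j) \<in> r" and \<alpha>: "\<alpha> \<in> carrier (Con_c (A i))" for i j \<alpha>
  proof -
    interpret i: valued_groupoid "D i" "F i" App "\<delta> i" "p i" "A i"
      using vg ij r(1) by blast
    interpret j: valued_groupoid "D j" "F j" App "\<delta> j" "p j" "A j"
      using vg ij r(1) by blast
    obtain d where d: "d \<in> carrier (D i)" "\<alpha> = i.ball d"
      using \<alpha> i.carrier_Con_c by blast
    have "Con_c_map (A j) (f i j) (i.ball d) = j.ball (\<phi> i j d)"
      by (rule Con_c_map_ball[OF i.valued_groupoid_axioms j.valued_groupoid_axioms _ \<phi>(1)[OF ij] _ _ d(1)])
        (use nat[OF ij] f[OF ij] in auto)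
    then show ?thesis
      using d \<phi>_closed[OF ij] by simp
  qed
  ultimately show ?thesis
    unfolding groupoid_lifting_def
    by (intro exI[of _ A] exI[of _ f] conjI exI[of _ "\<lambda>i. valued_groupoid.radius (D i) (F i) (\<delta> i) (p i)"]) auto
qed

end
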